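(* The map $\mathrm{Ind}^{\mathrm{GL}}_{\mathrm{UT}}=\bigoplus_{n\ge0}\mathrm{Ind}^{\mathrm{GL}_n}_{\mathrm{UT}_n}:\mathsf{cf}(\mathrm{UT}_\bullet)\to\mathsf{cf}(\mathrm{GL}_\bullet)$ is a graded Hopf algebra homomorphism.
   Context: Fix the finite field $\mathbb{F}_q$; $[n]=\{1,\dots,n\}$, $[i]^c=[n]\setminus[i]$. $\mathrm{GL}_n$ is the group of invertible $n\times n$ matrices over $\mathbb{F}_q$ and $\mathrm{UT}_n\le\mathrm{GL}_n$ the unipotent upper triangular matrices; $\mathsf{cf}(G)$ is the space of complex class functions; $\mathrm{Ind}$, $\mathrm{Res}$ are induction and restriction; for $K=L\ltimes R$, $\mathrm{Inf}^K_L\psi(lr)=\psi(l)$ and $\mathrm{Def}^K_L\psi(l)=\frac1{|R|}\sum_{x\in R}\psi(lx)$. Hopf algebra $\mathsf{cf}(\mathrm{UT}_\bullet)=\bigoplus_n\mathsf{cf}(\mathrm{UT}_n)$: for $I\subseteq[n]$, $I^c=[n]\setminus I$, let $\mathrm{UL}_I=\{g\in\mathrm{UT}_n:(g-1_n)_{i,j}\ne0\text{ only if }(i,j)\in I\times I\cup I^c\times I^c\}$, $\mathrm{UR}_I=\{g\in\mathrm{UT}_n:(g-1_n)_{i,j}\ne0\text{ only if }(i,j)\in I\times I^c\}$, $\mathrm{UP}_I=\{g\in\mathrm{UT}_n:(g-1_n)_{i,j}=0\text{ for }(i,j)\in I^c\times I\}=\mathrm{UL}_I\ltimes\mathrm{UR}_I$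 (and $\mathrm{UP}_{[i]}=\mathrm{UT}_n$). With $\mathrm{cano}_I:I\to[|I|]$ the order-preserving bijection, $\mathrm{UL}_I\cong\mathrm{UT}_{|I|}\times\mathrm{UT}_{|I^c|}$ by relabelling the $I\times I$ block via $\mathrm{cano}_I$ and the $I^c\times I^c$ block via $\mathrm{cano}_{I^c}$, inducing $\mathrm{st}_{(I,I^c)}:\mathsf{cf}(\mathrm{UL}_I)\to\mathsf{cf}(\mathrm{UT}_{|I|})\otimes\mathsf{cf}(\mathrm{UT}_{|I^c|})$. Product $\mu=\bigoplus_{n\ge i\ge0}\mathrm{Inf}^{\mathrm{UT}_n}_{\mathrm{UL}_{[i]}}\circ\mathrm{st}^{-1}_{([i],[i]^c)}$, coproduct $\Delta=\bigoplus_n\sum_{I\subseteq[n]}\mathrm{st}_{(I,I^c)}\circ\mathrm{Def}^{\mathrm{UP}_I}_{\mathrm{UL}_I}\circ\mathrm{Res}^{\mathrm{UT}_n}_{\mathrm{UP}_I}$. Zelevinsky's Hopf algebra $\mathsf{cf}(\mathrm{GL}_\bullet)=\bigoplus_n\mathsf{cf}(\mathrm{GL}_n)$: for $0\le i\le n$ let $L_i=\{g\in\mathrm{GL}_n: g_{r,s}\neq0\text{ only if }(r,s)\in[i]\times[i]\cup[i]^c\times[i]^c\}\cong\mathrm{GL}_i\times\mathrm{GL}_{n-i}$, $R_i=\{g:(g-1_n)_{r,s}\ne0\text{ only if }(r,s)\in[i]\times[i]^c\}$, $P_i=\{g: g_{r,s}=0\text{ for }(r,s)\in[i]^c\times[i]\}=L_i\ltimes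 R_i$; $\mathrm{st}_{([i],[i]^c)}:\mathsf{cf}(L_i)\to\mathsf{cf}(\mathrm{GL}_i)\otimes\mathsf{cf}(\mathrm{GL}_{n-i})$ is induced by that isomorphism. Product $\mu=\bigoplus_{n\ge i\ge0}\mathrm{Ind}^{\mathrm{GL}_n}_{P_i}\circ\mathrm{Inf}^{P_i}_{L_i}\circ\mathrm{st}^{-1}_{([i],[i]^c)}$, coproduct $\Delta=\bigoplus_n\sum_{i=0}^n\mathrm{st}_{([i],[i]^c)}\circ\mathrm{Def}^{P_i}_{L_i}\circ\mathrm{Res}^{\mathrm{GL}_n}_{P_i}$. *)

theory Defs
  imports Complex_Main
begin

type_synonym 'a mat = "nat \<Rightarrow> nat \<Rightarrow> 'a"

definition matn :: "nat \<Rightarrow> ('a::zero) mat set" where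
  "matn n = {A. \<forall>i j. (i \<notin> {1..n} \<or> j \<notin> {1..n}) \<longrightarrow> A i j = 0}"

definition mmult :: "nat \<Rightarrow> ('a::comm_ring_1) mat \<Rightarrow> 'a mat \<Rightarrow> 'a mat" where
  "mmult n A B = (\<lambda>i j. if i \<in> {1..n} \<and> j \<in> {1..n} then (\<Sum>k\<in>{1..n}. A i k * B k j) else 0)"

definition mone :: "nat \<Rightarrow> ('a::comm_ring_1) mat" where
  "mone n = (\<lambda>i j. if i = j \<and> i \<in> {1..n} then 1 else 0)"

definition minv :: "nat \<Rightarrow> ('a::comm_ring_1) mat \<Rightarrow> 'a mat" where
  "minv n A = (SOME B. B \<in> matn n \<and> mmult n A B = mone n \<and> mmult n B A = mone n)"

definition conjg :: "nat \<Rightarrow> ('a::comm_ring_1) mat \<Rightarrow> 'a mat \<Rightarrow> 'a mat" where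
  "conjg n x g = mmult n (mmult n (minv n x) g) x"

definition GL :: "nat \<Rightarrow> ('a::field) mat set" where
  "GL n = {A \<in> matn n. \<exists>B\<in>matn n. mmult n A B = mone n \<and> mmult n B A = mone n}"

definition UT :: "nat \<Rightarrow> ('a::field) mat set" where
  "UT n = {A \<in> matn n. \<forall>i\<in>{1..n}. \<forall>j\<in>{1..n}.
             (j < i \<longrightarrow> A i j = 0) \<and> (i = j \<longrightarrow> A i j = 1)}"

definition cf :: "nat \<Rightarrow> ('a::field) mat set \<Rightarrow> ('a mat \<Rightarrow> complex) set" where
  "cf n G = {f. (\<forall>g. g \<notin> G \<longrightarrow> f g = 0) \<and> (\<forall>g\<in>G. \<forall>x\<in>G. f (conjg n x g) = f g)}"

text \<open>Class functions on G x H: this represents cf(G) tensor cf(H).\<close>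
definition cf2 :: "nat \<Rightarrow> nat \<Rightarrow> ('a::field) mat set \<Rightarrow> 'a mat set
                   \<Rightarrow> ('a mat \<times> 'a mat \<Rightarrow> complex) set" where
  "cf2 m k G H = {F. (\<forall>a b. (a, b) \<notin> G \<times> H \<longrightarrow> F (a, b) = 0) \<and>
     (\<forall>a\<in>G. \<forall>b\<in>H. \<forall>x\<in>G. \<forall>y\<in>H. F (conjg m x a, conjg k y b) = F (a, b))}"

definition Ind :: "nat \<Rightarrow> ('a::field) mat set \<Rightarrow> 'a mat set \<Rightarrow> ('a mat \<Rightarrow> complex)
                    \<Rightarrow> 'a mat \<Rightarrow> complex" where
  "Ind n H G f = (\<lambda>g. if g \<in> G then
      (\<Sum>x\<in>{x\<in>G. conjg n x g \<in> H}. f (conjg n x g)) / of_nat (card H) else 0)"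

definition Res :: "('a::field) mat set \<Rightarrow> ('a mat \<Rightarrow> complex) \<Rightarrow> 'a mat \<Rightarrow> complex" where
  "Res H f = (\<lambda>g. if g \<in> H then f g else 0)"

text \<open>Inflation from L to K = L \<ltimes> R: Inf psi (l r) = psi l.\<close>
definition Inf :: "nat \<Rightarrow> ('a::field) mat set \<Rightarrow> 'a mat set \<Rightarrow> 'a mat set
                    \<Rightarrow> ('a mat \<Rightarrow> complex) \<Rightarrow> 'a mat \<Rightarrow> complex" where
  "Inf n K L R psi = (\<lambda>g. if g \<in> K then psi (THE l. l \<in> L \<and> (\<exists>r\<in>R. g = mmult n l r)) else 0)"

text \<open>Deflation from K = L \<ltimes> R to L: Def psi l = 1/|R| sum_{x in R} psi (l x).\<close>
definition Def :: "nat \<Rightarrow> ('a::field) mat set \<Rightarrow> 'a mat set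
                    \<Rightarrow> ('a mat \<Rightarrow> complex) \<Rightarrow> 'a mat \<Rightarrow> complex" where
  "Def n L R psi = (\<lambda>l. if l \<in> L then (\<Sum>x\<in>R. psi (mmult n l x)) / of_nat (card R) else 0)"

text \<open>Tensor product of two inductions (Ind tensor Ind), on class functions of a product.\<close>
definition Ind2 :: "nat \<Rightarrow> nat \<Rightarrow> ('a::field) mat set \<Rightarrow> 'a mat set \<Rightarrow> 'a mat set \<Rightarrow> 'a mat set
                    \<Rightarrow> ('a mat \<times> 'a mat \<Rightarrow> complex) \<Rightarrow> 'a mat \<times> 'a mat \<Rightarrow> complex" where
  "Ind2 m k H1 G1 H2 G2 F = (\<lambda>(x, y). if x \<in> G1 \<and> y \<in> G2 then
      (\<Sum>a\<in>{a\<in>G1. conjg m a x \<in> H1}. \<Sum>b\<in>{b\<in>G2. conjg k b y \<in> H2}.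
          F (conjg m a x, conjg k b y)) / (of_nat (card H1) * of_nat (card H2)) else 0)"

definition cano :: "nat set \<Rightarrow> nat \<Rightarrow> nat" where
  "cano I i = card {k\<in>I. k \<le> i}"

definition cano_inv :: "nat set \<Rightarrow> nat \<Rightarrow> nat" where
  "cano_inv I r = (THE i. i \<in> I \<and> cano I i = r)"

definition blk :: "nat set \<Rightarrow> ('a::zero) mat \<Rightarrow> 'a mat" where
  "blk I g = (\<lambda>r s. if r \<in> {1..card I} \<and> s \<in> {1..card I}
                     then g (cano_inv I r) (cano_inv I s) else 0)"

definition emb :: "nat \<Rightarrow> nat set \<Rightarrow> ('a::zero) mat \<Rightarrow> 'a mat \<Rightarrow> 'a mat" where
  "emb n I a b = (\<lambda>i j. if i \<in> I \<and> j \<in> I then a (cano I i) (cano I j)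
      else if i \<in> {1..n} - I \<and> j \<in> {1..n} - I
           then b (cano ({1..n} - I) i) (cano ({1..n} - I) j) else 0)"

definition st :: "(nat \<Rightarrow> ('a::field) mat set) \<Rightarrow> nat \<Rightarrow> nat set
                   \<Rightarrow> ('a mat \<Rightarrow> complex) \<Rightarrow> 'a mat \<times> 'a mat \<Rightarrow> complex" where
  "st G n I psi = (\<lambda>(a, b). if a \<in> G (card I) \<and> b \<in> G (n - card I)
                            then psi (emb n I a b) else 0)"

definition st_inv :: "('a::field) mat set \<Rightarrow> nat \<Rightarrow> nat set
                   \<Rightarrow> ('a mat \<times> 'a mat \<Rightarrow> complex) \<Rightarrow> 'a mat \<Rightarrow> complex" where
  "st_inv L n I F = (\<lambda>g. if g \<in> L then F (blk I g, blk ({1..n} - I) g) else 0)"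

definition UL :: "nat \<Rightarrow> nat set \<Rightarrow> ('a::field) mat set" where
  "UL n I = {g \<in> UT n. \<forall>i j. g i j \<noteq> mone n i j \<longrightarrow>
      (i \<in> I \<and> j \<in> I) \<or> (i \<in> {1..n} - I \<and> j \<in> {1..n} - I)}"

definition UR :: "nat \<Rightarrow> nat set \<Rightarrow> ('a::field) mat set" where
  "UR n I = {g \<in> UT n. \<forall>i j. g i j \<noteq> mone n i j \<longrightarrow> i \<in> I \<and> j \<in> {1..n} - I}"

definition UP :: "nat \<Rightarrow> nat set \<Rightarrow> ('a::field) mat set" where
  "UP n I = {g \<in> UT n. \<forall>i\<in>{1..n} - I. \<forall>j\<in>I. g i j = mone n i j}"

definition Lv :: "nat \<Rightarrow> nat \<Rightarrow> ('a::field) mat set" where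
  "Lv n i = {g \<in> GL n. \<forall>r s. g r s \<noteq> 0 \<longrightarrow>
      (r \<in> {1..i} \<and> s \<in> {1..i}) \<or> (r \<in> {1..n} - {1..i} \<and> s \<in> {1..n} - {1..i})}"

definition Rv :: "nat \<Rightarrow> nat \<Rightarrow> ('a::field) mat set" where
  "Rv n i = {g \<in> GL n. \<forall>r s. g r s \<noteq> mone n r s \<longrightarrow> r \<in> {1..i} \<and> s \<in> {1..n} - {1..i}}"

definition Pv :: "nat \<Rightarrow> nat \<Rightarrow> ('a::field) mat set" where
  "Pv n i = {g \<in> GL n. \<forall>r\<in>{1..n} - {1..i}. \<forall>s\<in>{1..i}. g r s = 0}"

definition muUT :: "nat \<Rightarrow> nat \<Rightarrow> (('a::field) mat \<times> 'a mat \<Rightarrow> complex) \<Rightarrow> 'a mat \<Rightarrow> complex" where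
  "muUT n i F = Inf n (UT n) (UL n {1..i}) (UR n {1..i}) (st_inv (UL n {1..i}) n {1..i} F)"

definition muGL :: "nat \<Rightarrow> nat \<Rightarrow> (('a::field) mat \<times> 'a mat \<Rightarrow> complex) \<Rightarrow> 'a mat \<Rightarrow> complex" where
  "muGL n i F = Ind n (Pv n i) (GL n)
      (Inf n (Pv n i) (Lv n i) (Rv n i) (st_inv (Lv n i) n {1..i} F))"

definition DeltaUT :: "nat \<Rightarrow> nat \<Rightarrow> (('a::field) mat \<Rightarrow> complex) \<Rightarrow> 'a mat \<times> 'a mat \<Rightarrow> complex" where
  "DeltaUT n i f = (\<lambda>ab. \<Sum>I\<in>{I. I \<subseteq> {1..n} \<and> card I = i}.
      st UT n I (Def n (UL n I) (UR n I) (Res (UP n I) f)) ab)"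

definition DeltaGL :: "nat \<Rightarrow> nat \<Rightarrow> (('a::field) mat \<Rightarrow> complex) \<Rightarrow> 'a mat \<times> 'a mat \<Rightarrow> complex" where
  "DeltaGL n i f = st GL n {1..i} (Def n (Lv n i) (Rv n i) (Res (Pv n i) f))"

text \<open>Unit: the element 1 of cf(UT_0) = cf(GL_0) = C (both groups are trivial).\<close>
definition unit0 :: "('a::field) mat \<Rightarrow> complex" where
  "unit0 = (\<lambda>g. if g = mone 0 then 1 else 0)"

text \<open>Counit: projection onto degree 0, cf(G_0) = C via evaluation at the identity.\<close>
definition counit0 :: "(('a::field) mat \<Rightarrow> complex) \<Rightarrow> complex" where
  "counit0 f = f (mone 0)"

definition IndGU :: "nat \<Rightarrow> (('a::field) mat \<Rightarrow> complex) \<Rightarrow> 'a mat \<Rightarrow> complex" where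
  "IndGU n f = Ind n (UT n) (GL n) f"

end

theory Submission
  imports Defs "HOL-Library.FuncSet"
begin

text \<open>
  Compatibility with the product is a reindexing: conjugating first by an element of \<open>GL\<^sub>n\<close> and
  then by a block diagonal matrix is conjugating by another element of \<open>GL\<^sub>n\<close>.

  For the coproduct, fix \<open>i\<close> and consider those \<open>x \<in> GL\<^sub>n\<close> whose lower \<open>n - i\<close> rows vanish in the
  columns \<open>I\<close>, for \<open>I \<subseteq> [n]\<close> of size \<open>i\<close>; this set is \<open>P\<^sub>i w\<^sub>I\<close> for a block permutation matrix \<open>w\<^sub>I\<close>.
  The parabolic Bruhat decomposition is used in the following form: for every \<open>x \<in> GL\<^sub>n\<close> there is
  exactly one \<open>I\<close> such that \<open>x u \<in> P\<^sub>i w\<^sub>I\<close> for some \<open>u \<in> UT\<^sub>n\<close>, and these \<open>u\<close> form a coset of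
  \<open>UP\<^sub>I\<close>. A sum over \<open>GL\<^sub>n\<close> of a right \<open>UT\<^sub>n\<close>-invariant function thereby becomes a sum over \<open>I\<close> and
  over \<open>z \<in> P\<^sub>i w\<^sub>I\<close>, and conjugation by \<open>z\<close> carries the block upper triangular matrices with
  diagonal blocks \<open>a, b\<close> to the matrices that are block triangular with respect to \<open>I\<close> with diagonal
  blocks conjugate to \<open>a, b\<close>. This produces the sum over \<open>I\<close> in the coproduct of the unitriangular side.
\<close>

subsection \<open>Matrices\<close>

lemma mmult_matn [simp]: "mmult n A B \<in> matn n"
  by (auto simp: mmult_def matn_def)

lemma mone_matn [simp]: "mone n \<in> matn n"
  by (auto simp: mone_def matn_def)

lemma mmult_assoc: "mmult n (mmult n A B) C = mmult n A (mmult n B C)"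
proof (intro ext)
  fix i j
  show "mmult n (mmult n A B) C i j = mmult n A (mmult n B C) i j"
  proof (cases "i \<in> {1..n} \<and> j \<in> {1..n}")
    case True
    then have "mmult n (mmult n A B) C i j = (\<Sum>k = 1..n. (\<Sum>l = 1..n. A i l * B l k) * C k j)"
      by (simp add: mmult_def)
    also have "\<dots> = (\<Sum>k = 1..n. \<Sum>l = 1..n. A i l * (B l k * C k j))"
      by (simp add: sum_distrib_right mult.assoc)
    also have "\<dots> = (\<Sum>l = 1..n. A i l * (\<Sum>k = 1..n. B l k * C k j))"
      unfolding sum_distrib_left by (rule sum.swap)
    also have "\<dots> = mmult n A (mmult n B C) i j"
      using True by (simp add: mmult_def)
    finally show ?thesis .
  qed (auto simp: mmult_def)
qed

lemma mmult_mone_left [simp]: "A \<in> matn n \<Longrightarrow> mmult n (mone n) A = A"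
proof (intro ext)
  fix i j assume A: "A \<in> matn n"
  have "(\<Sum>k = 1..n. mone n i k * A k j) = (\<Sum>k = 1..n. if k = i then A k j else 0)"
    by (intro sum.cong) (auto simp: mone_def)
  then show "mmult n (mone n) A i j = A i j"
    using A by (auto simp: mmult_def matn_def)
qed

lemma mmult_mone_right [simp]: "A \<in> matn n \<Longrightarrow> mmult n A (mone n) = A"
proof (intro ext)
  fix i j assume A: "A \<in> matn n"
  have "(\<Sum>k = 1..n. A i k * mone n k j) = (\<Sum>k = 1..n. if k = j then A i k else 0)"
    by (intro sum.cong) (auto simp: mone_def)
  then show "mmult n A (mone n) i j = A i j"
    using A by (auto simp: mmult_def matn_def)
qed

lemma finite_matn [simp]: "finite (matn n :: 'a::{finite,zero} mat set)"
proof -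
  let ?V = "{v :: nat \<Rightarrow> 'a. \<forall>j. (j \<in> {1..n} \<longrightarrow> v j \<in> UNIV) \<and> (j \<notin> {1..n} \<longrightarrow> v j = 0)}"
  have V: "finite ?V"
    using finite_set_of_finite_funs[of "{1..n}" "UNIV :: 'a set" 0] by simp
  \<comment> \<open>The same finiteness principle a second time: a matrix is a function from row
    indices to the rows collected in \<open>?V\<close>, with the zero row as default.\<close>
  have "finite {g :: 'a mat. \<forall>i. (i \<in> {1..n} \<longrightarrow> g i \<in> ?V) \<and> (i \<notin> {1..n} \<longrightarrow> g i = (\<lambda>_. 0))}"
    by (rule finite_set_of_finite_funs[OF _ V]) auto
  then show ?thesis
    by (rule rev_finite_subset) (auto simp: matn_def fun_eq_iff)
qed

subsection \<open>The general linear group\<close>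

lemma GL_matn [simp]: "A \<in> GL n \<Longrightarrow> A \<in> matn n"
  by (simp add: GL_def)

lemma GL_I: "A \<in> matn n \<Longrightarrow> B \<in> matn n \<Longrightarrow> mmult n A B = mone n \<Longrightarrow> mmult n B A = mone n \<Longrightarrow> A \<in> GL n"
  unfolding GL_def by blast

lemma minv:
  assumes "A \<in> GL n"
  shows minv_matn [simp]: "minv n A \<in> matn n"
    and mmult_minv [simp]: "mmult n A (minv n A) = mone n"
    and minv_mmult [simp]: "mmult n (minv n A) A = mone n"
proof -
  have "\<exists>B. B \<in> matn n \<and> mmult n A B = mone n \<and> mmult n B A = mone n"
    using assms unfolding GL_def by blast
  from someI_ex[OF this] show "minv n A \<in> matn n" "mmult n A (minv n A) = mone n"
      "mmult n (minv n A) A = mone n"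
    unfolding minv_def by blast+
qed

lemma minv_GL [simp]: "A \<in> GL n \<Longrightarrow> minv n A \<in> GL n"
  by (rule GL_I[of _ _ A]) auto

lemma minv_cancel [simp]:
  assumes "A \<in> GL n" "B \<in> matn n"
  shows "mmult n A (mmult n (minv n A) B) = B" "mmult n (minv n A) (mmult n A B) = B"
  using assms by (simp_all flip: mmult_assoc)

lemma mmult_left_cancel:
  assumes "A \<in> GL n" "B \<in> matn n" "C \<in> matn n" "mmult n A B = mmult n A C"
  shows "B = C"
  by (metis assms minv_cancel(2))

lemma minv_unique:
  assumes "A \<in> GL n" "B \<in> matn n" "mmult n A B = mone n"
  shows "minv n A = B"
  using assms by (intro mmult_left_cancel[of A n "minv n A" B]) auto

lemma minv_minv [simp]: "A \<in> GL n \<Longrightarrow> minv n (minv n A) = A"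
  by (rule minv_unique) auto

lemma mone_GL [simp]: "mone n \<in> GL n"
  by (rule GL_I[of _ _ "mone n"]) auto

lemma minv_mone [simp]: "minv n (mone n :: ('a::field) mat) = mone n"
  by (rule minv_unique) auto

text \<open>A left and a right inverse of \<open>B\<close> coincide by associativity; this later
  turns one-sided inverses in \<open>UT n\<close> into two-sided ones.\<close>

lemma GL_right_inverse_unique:
  assumes "A \<in> matn n" "B \<in> matn n" "C \<in> matn n" "mmult n A B = mone n" "mmult n B C = mone n"
  shows "A = C"
proof -
  have "A = mmult n A (mmult n B C)" by (simp add: assms)
  also have "\<dots> = mmult n (mmult n A B) C" by (simp only: mmult_assoc)
  also have "\<dots> = C" by (simp add: assms)
  finally show ?thesis .
qed

lemma mmult_GL [simp]:
  assumes "A \<in> GL n" "B \<in> GL n"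
  shows "mmult n A B \<in> GL n"
  using assms
  by (intro GL_I[of _ _ "mmult n (minv n B) (minv n A)"]) (simp_all add: mmult_assoc)

lemma minv_mult:
  assumes "A \<in> GL n" "B \<in> GL n"
  shows "minv n (mmult n A B) = mmult n (minv n B) (minv n A)"
  using assms by (intro minv_unique) (simp_all add: mmult_assoc)

lemma finite_GL [simp]: "finite (GL n :: 'a::{finite,field} mat set)"
  by (rule finite_subset[OF _ finite_matn[of n]]) auto

lemma bij_GL_right:
  assumes "y \<in> GL n"
  shows "bij_betw (\<lambda>x. mmult n x y) (GL n) (GL n)"
  by (rule bij_betw_byWitness[where f' = "\<lambda>x. mmult n x (minv n y)"])
     (use assms in \<open>auto simp: mmult_assoc\<close>)

lemma bij_GL_left:
  assumes "y \<in> GL n"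
  shows "bij_betw (\<lambda>x. mmult n y x) (GL n) (GL n)"
  by (rule bij_betw_byWitness[where f' = "\<lambda>x. mmult n (minv n y) x"])
     (use assms in auto)

text \<open>A finite submonoid of a group is a subgroup: left multiplication by \<open>A\<close> is
  injective on the finite set \<open>S\<close>, hence onto, so it reaches the identity.\<close>

lemma minv_closed:
  fixes S :: "'a::{finite,field} mat set"
  assumes S: "S \<subseteq> GL n" and mone: "mone n \<in> S"
    and mult: "\<And>A B. A \<in> S \<Longrightarrow> B \<in> S \<Longrightarrow> mmult n A B \<in> S" and A: "A \<in> S"
  shows "minv n A \<in> S"
proof -
  have "finite S" using S finite_subset finite_GL by blast
  moreover have "inj_on (mmult n A) S"
  proof (rule inj_onI)
    fix B C assume "B \<in> S" "C \<in> S" "mmult n A B = mmult n A C"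
    then show "B = C" using S A by (intro mmult_left_cancel[of A n B C]) auto
  qed
  moreover have "mmult n A ` S \<subseteq> S" using mult A by auto
  ultimately have "mmult n A ` S = S" by (simp add: endo_inj_surj)
  then obtain B where "B \<in> S" "mmult n A B = mone n" using mone by force
  moreover have "minv n A = B"
    using calculation S A by (intro minv_unique) auto
  ultimately show ?thesis by simp
qed

lemma conjg_matn [simp]: "conjg n x g \<in> matn n"
  by (simp add: conjg_def)

lemma conjg_conjg: "x \<in> GL n \<Longrightarrow> y \<in> GL n \<Longrightarrow> conjg n x (conjg n y g) = conjg n (mmult n y x) g"
  by (simp add: conjg_def minv_mult mmult_assoc)

lemma conjg_mone [simp]: "g \<in> matn n \<Longrightarrow> conjg n (mone n :: ('a::field) mat) g = g"
  by (simp add: conjg_def)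

lemma conjg_GL [simp]: "x \<in> GL n \<Longrightarrow> g \<in> GL n \<Longrightarrow> conjg n x g \<in> GL n"
  by (simp add: conjg_def)

subsection \<open>The unitriangular group\<close>

lemma UT_matn [simp]: "A \<in> UT n \<Longrightarrow> A \<in> matn n"
  by (simp add: UT_def)

lemma UT_lower: "A \<in> UT n \<Longrightarrow> j < i \<Longrightarrow> A i j = 0"
  unfolding UT_def matn_def by blast

lemma UT_diag: "A \<in> UT n \<Longrightarrow> i \<in> {1..n} \<Longrightarrow> A i i = 1"
  unfolding UT_def by blast

lemma mone_UT [simp]: "mone n \<in> UT n"
  by (auto simp: UT_def mone_def matn_def)

lemma mmult_UT [simp]:
  assumes A: "A \<in> UT n" and B: "B \<in> UT n"
  shows "mmult n A B \<in> UT n"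
proof -
  have "(\<Sum>k = 1..n. A i k * B k j) = 0" if "j < i" for i j
  proof (intro sum.neutral ballI)
    fix k show "A i k * B k j = 0"
      using that UT_lower[OF A, of k i] UT_lower[OF B, of j k] by (cases "k < i") auto
  qed
  moreover have "(\<Sum>k = 1..n. A i k * B k i) = 1" if i: "i \<in> {1..n}" for i
  proof -
    have "(\<Sum>k = 1..n. A i k * B k i) = (\<Sum>k = 1..n. if k = i then 1 else 0)"
    proof (intro sum.cong refl)
      fix k assume "k \<in> {1..n}"
      then show "A i k * B k i = (if k = i then 1 else 0)"
        using UT_lower[OF A, of k i] UT_lower[OF B, of i k] UT_diag[OF A i] UT_diag[OF B i]
        by (cases k i rule: linorder_cases) auto
    qed
    then show ?thesis using i by simp
  qed
  ultimately show ?thesis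
    unfolding UT_def by (auto simp: mmult_def matn_def)
qed

lemma UT_mmult_inj:
  assumes u: "u \<in> UT n" and A: "A \<in> matn n" and B: "B \<in> matn n" and eq: "mmult n u A = mmult n u B"
  shows "A = B"
proof (rule ccontr)
  assume "A \<noteq> B"
  then obtain i0 j where ij: "A i0 j \<noteq> B i0 j" by (auto simp: fun_eq_iff)
  define S where "S = {i. A i j \<noteq> B i j}"
  have SN: "S \<subseteq> {1..n}" and j: "j \<in> {1..n}"
    using A B ij by (auto simp: S_def matn_def) metis+
  have fin: "finite S" using SN finite_subset by blast
  define k where "k = Max S"
  have k: "k \<in> S" unfolding k_def using fin ij by (intro Max_in) (auto simp: S_def)
  have max: "A i j = B i j" if "k < i" for i
    using Max_ge[OF fin, of i] that by (fastforce simp: S_def k_def)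
  have kn: "k \<in> {1..n}" using k SN by auto
  have "mmult n u A k j - mmult n u B k j = (\<Sum>l = 1..n. u k l * (A l j - B l j))"
    using kn j by (simp add: mmult_def sum_subtractf right_diff_distrib)
  also have "\<dots> = (\<Sum>l = 1..n. if l = k then A k j - B k j else 0)"
  proof (intro sum.cong refl)
    fix l
    show "u k l * (A l j - B l j) = (if l = k then A k j - B k j else 0)"
      using UT_lower[OF u, of l k] UT_diag[OF u kn] max[of l]
      by (cases l k rule: linorder_cases) auto
  qed
  also have "\<dots> = A k j - B k j" using kn by simp
  finally show False using eq k by (simp add: S_def)
qed

lemma finite_UT [simp]: "finite (UT n :: 'a::{finite,field} mat set)"
  by (rule finite_subset[OF _ finite_matn[of n]]) auto

text \<open>Pigeonhole replaces an explicit inverse: left multiplication by \<open>u\<close> is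
  injective on the finite set \<open>UT n\<close>, hence onto.\<close>

lemma UT_right_inverse:
  fixes u :: "'a::{finite,field} mat"
  assumes u: "u \<in> UT n"
  shows "\<exists>v\<in>UT n. mmult n u v = mone n"
proof -
  have "inj_on (mmult n u) (UT n)"
    using UT_mmult_inj[OF u] by (auto intro!: inj_onI)
  moreover have "mmult n u ` UT n \<subseteq> UT n" using u by auto
  ultimately have "mmult n u ` UT n = UT n" by (simp add: endo_inj_surj)
  then show ?thesis using mone_UT[of n] by (metis imageE)
qed

lemma UT_GL [simp]:
  fixes u :: "'a::{finite,field} mat"
  assumes u: "u \<in> UT n"
  shows "u \<in> GL n"
proof -
  obtain v where v: "v \<in> UT n" "mmult n u v = mone n" using UT_right_inverse u by blast
  \<comment> \<open>A right inverse \<open>t\<close> of the right inverse \<open>v\<close> must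
    equal \<open>u\<close>, which makes \<open>v\<close> a two-sided inverse.\<close>
  obtain t where t: "t \<in> UT n" "mmult n v t = mone n" using UT_right_inverse v by blast
  have "u = t" using GL_right_inverse_unique[of u n v t] u v t by simp
  then show ?thesis using GL_I[of u n v] u v t by simp
qed

lemma minv_UT [simp]:
  fixes u :: "'a::{finite,field} mat"
  shows "u \<in> UT n \<Longrightarrow> minv n u \<in> UT n"
  by (rule minv_closed[of "UT n"]) auto

lemma conjg_UT_iff:
  fixes u :: "'a::{finite,field} mat"
  assumes u: "u \<in> UT n" and g: "g \<in> matn n"
  shows "conjg n u g \<in> UT n \<longleftrightarrow> g \<in> UT n"
proof
  assume "conjg n u g \<in> UT n"
  then have "mmult n (mmult n u (conjg n u g)) (minv n u) \<in> UT n" using u by simp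
  then show "g \<in> UT n" using u g by (simp add: conjg_def mmult_assoc)
next
  assume "g \<in> UT n" then show "conjg n u g \<in> UT n" using u by (simp add: conjg_def)
qed

subsection \<open>Relabelling\<close>

lemma cano_strict_mono:
  assumes "finite I" "j \<in> I" "i < j"
  shows "cano I i < cano I j"
proof -
  have "j \<in> {k \<in> I. k \<le> j} - {k \<in> I. k \<le> i}" using assms by auto
  moreover have "{k \<in> I. k \<le> i} \<subseteq> {k \<in> I. k \<le> j}" using assms by auto
  ultimately have "{k \<in> I. k \<le> i} \<subset> {k \<in> I. k \<le> j}" by blast
  then show ?thesis
    unfolding cano_def using assms(1) by (simp add: psubset_card_mono)
qed

lemma cano_less_iff:
  assumes "finite I" "i \<in> I" "j \<in> I"
  shows "cano I i < cano I j \<longleftrightarrow> i < j"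
  using assms cano_strict_mono[of I j i] cano_strict_mono[of I i j]
  by (metis linorder_neqE_nat not_less_iff_gr_or_eq)

lemma bij_betw_cano:
  assumes "finite I"
  shows "bij_betw (cano I) I {1..card I}"
proof -
  have inj: "inj_on (cano I) I"
    using assms cano_strict_mono by (metis (no_types, lifting) inj_onI linorder_neqE_nat nat_neq_iff)
  moreover have "cano I ` I \<subseteq> {1..card I}"
  proof (rule image_subsetI)
    fix i assume i: "i \<in> I"
    then have "card {i} \<le> cano I i" unfolding cano_def
      using assms by (intro card_mono) auto
    moreover have "cano I i \<le> card I" unfolding cano_def
      using assms by (intro card_mono) auto
    ultimately show "cano I i \<in> {1..card I}" by simp
  qed
  ultimately show ?thesis
    unfolding bij_betw_def using card_image[OF inj] card_subset_eq[of "{1..card I}" "cano I ` I"] by simp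
qed

lemma cano_inv_cano [simp]:
  assumes "finite I" "i \<in> I"
  shows "cano_inv I (cano I i) = i"
  unfolding cano_inv_def
  using bij_betw_cano[OF assms(1)] assms(2) by (auto simp: bij_betw_def inj_on_def)

lemma cano_range: "finite I \<Longrightarrow> i \<in> I \<Longrightarrow> cano I i \<in> {1..card I}"
  using bij_betw_cano bij_betwE by blast

lemma cano_inv:
  assumes "finite I" "r \<in> {1..card I}"
  shows cano_inv_in: "cano_inv I r \<in> I" and cano_cano_inv: "cano I (cano_inv I r) = r"
proof -
  obtain i where i: "i \<in> I" "r = cano I i"
    using bij_betw_imp_surj_on[OF bij_betw_cano[OF assms(1)]] assms(2) by (metis imageE)
  then show "cano_inv I r \<in> I" "cano I (cano_inv I r) = r" using assms by simp_all
qed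

lemma bij_betw_cano_inv:
  assumes "finite I"
  shows "bij_betw (cano_inv I) {1..card I} I"
  by (rule bij_betw_byWitness[where f' = "cano I"])
     (use assms cano_inv[OF assms] cano_range[OF assms] in auto)

subsection \<open>Rectangular blocks\<close>

text \<open>Row and column index sets may differ because a matrix of P_i w_I has its rows split at
  \<open>{1..i}\<close> but its columns split along \<open>I\<close>.\<close>

definition blkr :: "nat set \<Rightarrow> nat set \<Rightarrow> ('a::zero) mat \<Rightarrow> 'a mat" where
  "blkr I J g = (\<lambda>r s. if r \<in> {1..card I} \<and> s \<in> {1..card J}
                      then g (cano_inv I r) (cano_inv J s) else 0)"

definition cblkr :: "nat \<Rightarrow> nat set \<Rightarrow> nat set \<Rightarrow> ('a::zero) mat \<Rightarrow> 'a mat" where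
  "cblkr n I J = blkr ({1..n} - I) ({1..n} - J)"

definition embr :: "nat \<Rightarrow> nat set \<Rightarrow> nat set \<Rightarrow> ('a::zero) mat \<Rightarrow> 'a mat \<Rightarrow> 'a mat" where
  "embr n I J a b = (\<lambda>i j. if i \<in> I \<and> j \<in> J then a (cano I i) (cano J j)
      else if i \<in> {1..n} - I \<and> j \<in> {1..n} - J
           then b (cano ({1..n} - I) i) (cano ({1..n} - J) j) else 0)"

text \<open>For \<open>I = J\<close> these are the block triangular matrices of one splitting; the
  invertible elements of \<open>Zr n {1..i} I\<close> form the set P_i w_I. The set
  \<open>Dr\<close> is the block diagonal part.\<close>

definition Zr :: "nat \<Rightarrow> nat set \<Rightarrow> nat set \<Rightarrow> ('a::zero) mat set" where
  "Zr n I J = {g \<in> matn n. \<forall>i\<in>{1..n} - I. \<forall>j\<in>J. g i j = 0}"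

definition Dr :: "nat \<Rightarrow> nat set \<Rightarrow> nat set \<Rightarrow> ('a::zero) mat set" where
  "Dr n I J = {g \<in> Zr n I J. \<forall>i\<in>I. \<forall>j\<in>{1..n} - J. g i j = 0}"

lemma blk_eq_blkr: "blk I = blkr I I"
  by (simp add: blk_def blkr_def fun_eq_iff)

lemma emb_eq_embr: "emb n I = embr n I I"
  by (simp add: emb_def embr_def fun_eq_iff)

lemma blkr_matn [simp]: "card I = m \<Longrightarrow> card J = m \<Longrightarrow> blkr I J g \<in> matn m"
  by (auto simp: blkr_def matn_def)

lemma Zr_matn [simp]: "g \<in> Zr n I J \<Longrightarrow> g \<in> matn n"
  by (simp add: Zr_def)

lemma Dr_Zr [simp]: "g \<in> Dr n I J \<Longrightarrow> g \<in> Zr n I J"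
  by (simp add: Dr_def)

lemma Zr_zero: "g \<in> Zr n I J \<Longrightarrow> i \<notin> I \<Longrightarrow> j \<in> J \<Longrightarrow> g i j = 0"
  unfolding Zr_def matn_def by blast

lemma Dr_zero: "g \<in> Dr n I J \<Longrightarrow> i \<in> I \<Longrightarrow> j \<notin> J \<Longrightarrow> g i j = 0"
  unfolding Dr_def Zr_def matn_def by blast

lemma ZrI: "g \<in> matn n \<Longrightarrow> (\<And>i j. i \<in> {1..n} - I \<Longrightarrow> j \<in> J \<Longrightarrow> g i j = 0) \<Longrightarrow> g \<in> Zr n I J"
  unfolding Zr_def by blast

lemma DrI: "g \<in> Zr n I J \<Longrightarrow> (\<And>i j. i \<in> I \<Longrightarrow> j \<in> {1..n} - J \<Longrightarrow> g i j = 0) \<Longrightarrow> g \<in> Dr n I J"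
  unfolding Dr_def by blast

lemma subset_interval_finite: "I \<subseteq> {1..n::nat} \<Longrightarrow> finite I"
  using finite_subset by blast

lemma card_Diff_interval: "I \<subseteq> {1..n::nat} \<Longrightarrow> card I = m \<Longrightarrow> card ({1..n} - I) = n - m"
  by (simp add: card_Diff_subset subset_interval_finite)

lemma cblkr_matn [simp]:
  "I \<subseteq> {1..n} \<Longrightarrow> card I = m \<Longrightarrow> J \<subseteq> {1..n} \<Longrightarrow> card J = m \<Longrightarrow> cblkr n I J g \<in> matn (n - m)"
  unfolding cblkr_def by (intro blkr_matn card_Diff_interval)

text \<open>The inner sum over \<open>{1..n}\<close> collapses to \<open>J\<close> by the vanishing
  hypothesis and is then relabelled through \<open>cano_inv J\<close>.\<close>

lemma blkr_mmult:
  fixes g h :: "('a::comm_ring_1) mat"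
  assumes I: "I \<subseteq> {1..n}" "card I = m" and J: "J \<subseteq> {1..n}" "card J = m"
    and K: "K \<subseteq> {1..n}" "card K = m"
    and zero: "\<And>i j k. i \<in> I \<Longrightarrow> j \<in> {1..n} - J \<Longrightarrow> k \<in> K \<Longrightarrow> g i j * h j k = 0"
  shows "blkr I K (mmult n g h) = mmult m (blkr I J g) (blkr J K h)"
proof (intro ext)
  fix r s
  show "blkr I K (mmult n g h) r s = mmult m (blkr I J g) (blkr J K h) r s"
  proof (cases "r \<in> {1..m} \<and> s \<in> {1..m}")
    case True
    define i k where "i = cano_inv I r" and "k = cano_inv K s"
    have ik: "i \<in> I" "k \<in> K"
      using True I K cano_inv_in[of I r] cano_inv_in[of K s] subset_interval_finite
      unfolding i_def k_def by auto
    then have ik': "i \<in> {1..n}" "k \<in> {1..n}" using I K by auto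
    have "blkr I K (mmult n g h) r s = (\<Sum>j = 1..n. g i j * h j k)"
      using True I K ik' by (simp add: blkr_def mmult_def i_def k_def)
    also have "\<dots> = (\<Sum>j\<in>J. g i j * h j k)"
      using J zero ik by (intro sum.mono_neutral_right) auto
    also have "\<dots> = (\<Sum>t = 1..m. g i (cano_inv J t) * h (cano_inv J t) k)"
      using sum.reindex_bij_betw[OF bij_betw_cano_inv[OF subset_interval_finite[OF J(1)]],
          of "\<lambda>j. g i j * h j k"] J by simp
    also have "\<dots> = mmult m (blkr I J g) (blkr J K h) r s"
      using True I J K by (simp add: blkr_def mmult_def i_def k_def)
    finally show ?thesis .
  qed (use I K in \<open>auto simp: blkr_def mmult_def\<close>)
qed

lemma Zr_mmult:
  assumes g: "g \<in> Zr n I J" and h: "h \<in> Zr n J K"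
  shows "mmult n g h \<in> Zr n I K"
proof (rule ZrI)
  fix i k assume ik: "i \<in> {1..n} - I" "k \<in> K"
  have "(\<Sum>j = 1..n. g i j * h j k) = 0"
  proof (intro sum.neutral ballI)
    fix j
    show "g i j * h j k = 0"
      using Zr_zero[OF g, of i j] Zr_zero[OF h, of j k] ik by (cases "j \<in> J") auto
  qed
  then show "mmult n g h i k = 0" by (simp add: mmult_def)
qed simp

lemma Dr_mmult:
  assumes g: "g \<in> Dr n I J" and h: "h \<in> Dr n J K"
  shows "mmult n g h \<in> Dr n I K"
proof (rule DrI)
  fix i k assume ik: "i \<in> I" "k \<in> {1..n} - K"
  have "(\<Sum>j = 1..n. g i j * h j k) = 0"
  proof (intro sum.neutral ballI)
    fix j
    show "g i j * h j k = 0"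
      using Dr_zero[OF g, of i j] Dr_zero[OF h, of j k] ik by (cases "j \<in> J") auto
  qed
  then show "mmult n g h i k = 0" by (simp add: mmult_def)
qed (rule Zr_mmult[OF Dr_Zr[OF g] Dr_Zr[OF h]])

text \<open>For the \<open>I\<close>, \<open>K\<close> block the factor that vanishes is the entry
  of \<open>h\<close>; for the complementary block it is the entry of \<open>g\<close>.\<close>

lemma blkr_mmult_Zr:
  fixes g h :: "('a::comm_ring_1) mat"
  assumes IJK: "I \<subseteq> {1..n}" "card I = m" "J \<subseteq> {1..n}" "card J = m" "K \<subseteq> {1..n}" "card K = m"
    and g: "g \<in> Zr n I J" and h: "h \<in> Zr n J K"
  shows "blkr I K (mmult n g h) = mmult m (blkr I J g) (blkr J K h)"
    and "cblkr n I K (mmult n g h)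
       = mmult (n - m) (cblkr n I J g) (cblkr n J K h)"
proof -
  show "blkr I K (mmult n g h) = mmult m (blkr I J g) (blkr J K h)"
    using IJK by (intro blkr_mmult) (simp_all add: Zr_zero[OF h])
  have "card ({1..n} - I) = n - m" "card ({1..n} - J) = n - m" "card ({1..n} - K) = n - m"
    using IJK card_Diff_interval by blast+
  then show "cblkr n I K (mmult n g h)
       = mmult (n - m) (cblkr n I J g) (cblkr n J K h)"
    unfolding cblkr_def by (intro blkr_mmult) (auto simp: Zr_zero[OF g])
qed

lemma embr_Dr [simp]:
  assumes "I \<subseteq> {1..n}" "J \<subseteq> {1..n}"
  shows "embr n I J a b \<in> Dr n I J"
proof (intro DrI ZrI)
  have 1: "i \<in> {1..n}" if "i \<in> I" for i using that assms by blast
  have 2: "j \<in> {1..n}" if "j \<in> J" for j using that assms by blast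
  show "embr n I J a b \<in> matn n"
    unfolding matn_def embr_def using 1 2 by (simp del: atLeastAtMost_iff)
qed (simp_all add: embr_def)

lemma embr_Zr [simp]: "I \<subseteq> {1..n} \<Longrightarrow> J \<subseteq> {1..n} \<Longrightarrow> embr n I J a b \<in> Zr n I J"
  by simp

lemma embr_matn [simp]: "I \<subseteq> {1..n} \<Longrightarrow> J \<subseteq> {1..n} \<Longrightarrow> embr n I J a b \<in> matn n"
  using embr_Zr Zr_matn by blast

lemma embr_blkr:
  assumes I: "I \<subseteq> {1..n}" and J: "J \<subseteq> {1..n}" and g: "g \<in> Dr n I J"
  shows "embr n I J (blkr I J g) (cblkr n I J g) = g"
proof (intro ext)
  fix i j
  have fin: "finite I" "finite J" "finite ({1..n} - I)" "finite ({1..n} - J)"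
    using I J subset_interval_finite by auto
  have 0: "g i j = 0" if "i \<notin> {1..n} \<or> j \<notin> {1..n}"
    using that g unfolding Dr_def Zr_def matn_def by blast
  show "embr n I J (blkr I J g) (cblkr n I J g) i j = g i j"
    using cano_range[OF fin(1), of i] cano_range[OF fin(2), of j] fin 0
      cano_range[OF fin(3), of i] cano_range[OF fin(4), of j]
      Zr_zero[OF Dr_Zr[OF g], of i j] Dr_zero[OF g, of i j]
    unfolding cblkr_def embr_def blkr_def by (auto simp del: atLeastAtMost_iff)
qed

lemma blkr_embr [simp]:
  assumes I: "I \<subseteq> {1..n}" "card I = m" and J: "J \<subseteq> {1..n}" "card J = m"
  shows "a \<in> matn m \<Longrightarrow> blkr I J (embr n I J a b) = a"
    and "b \<in> matn (n - m) \<Longrightarrow> cblkr n I J (embr n I J a b) = b"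
proof -
  have fin: "finite I" "finite J" "finite ({1..n} - I)" "finite ({1..n} - J)"
    using I J subset_interval_finite by auto
  have c: "card ({1..n} - I) = n - m" "card ({1..n} - J) = n - m"
    using I J card_Diff_interval by blast+
  show "blkr I J (embr n I J a b) = a" if a: "a \<in> matn m"
  proof (intro ext)
    fix r s
    show "blkr I J (embr n I J a b) r s = a r s"
      using a I J cano_inv[OF fin(1), of r] cano_inv[OF fin(2), of s]
      unfolding embr_def blkr_def matn_def by auto
  qed
  show "cblkr n I J (embr n I J a b) = b" if b: "b \<in> matn (n - m)"
  proof (intro ext)
    fix r s
    show "cblkr n I J (embr n I J a b) r s = b r s"
      using b c cano_inv[OF fin(3), of r] cano_inv[OF fin(4), of s]
      unfolding cblkr_def embr_def blkr_def matn_def by auto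
  qed
qed

text \<open>A block diagonal matrix is recovered from its diagonal blocks, so only the blocks of the
  product have to be computed.\<close>

lemma embr_mmult:
  fixes a b a' b' :: "('a::comm_ring_1) mat"
  assumes IJK: "I \<subseteq> {1..n}" "card I = m" "J \<subseteq> {1..n}" "card J = m" "K \<subseteq> {1..n}" "card K = m"
    and ab: "a \<in> matn m" "b \<in> matn (n - m)" "a' \<in> matn m" "b' \<in> matn (n - m)"
  shows "mmult n (embr n I J a b) (embr n J K a' b') = embr n I K (mmult m a a') (mmult (n - m) b b')"
proof -
  let ?g = "mmult n (embr n I J a b) (embr n J K a' b')"
  have "embr n I K (blkr I K ?g) (cblkr n I K ?g) = ?g"
    using IJK by (intro embr_blkr Dr_mmult[OF embr_Dr embr_Dr]) auto
  then show ?thesis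
    using blkr_mmult_Zr[OF IJK, of "embr n I J a b" "embr n J K a' b'"] IJK ab by simp
qed

lemma mone_Zr [simp]: "mone n \<in> Zr n I I"
  by (auto simp: Zr_def mone_def matn_def)

lemma blkr_mone:
  assumes "finite I" "card I = m" "I \<subseteq> {1..n}"
  shows "blkr I I (mone n) = mone m"
proof (intro ext)
  fix r s
  show "blkr I I (mone n) r s = mone m r s"
  proof (cases "r \<in> {1..m} \<and> s \<in> {1..m}")
    case True
    then have "cano_inv I r = cano_inv I s \<longleftrightarrow> r = s" "cano_inv I r \<in> {1..n}"
      using assms cano_cano_inv[OF assms(1)] cano_inv_in[OF assms(1)] by (metis, blast)
    then show ?thesis using True assms(2) by (simp add: blkr_def mone_def)
  next
    case False
    then show ?thesis
      by (cases "r = s") (simp_all add: blkr_def mone_def assms(2) del: atLeastAtMost_iff)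
  qed
qed

lemma blkr_mone' [simp]:
  assumes "I \<subseteq> {1..n}" "card I = m"
  shows "blkr I I (mone n) = mone m" "cblkr n I I (mone n) = mone (n - m)"
proof -
  have "finite ({1..n} - I)" by simp
  then show "blkr I I (mone n) = mone m" "cblkr n I I (mone n) = mone (n - m)"
    using assms card_Diff_interval[OF assms] unfolding cblkr_def
    by (intro blkr_mone subset_interval_finite[OF assms(1)]; blast)+
qed

lemma mone_Dr [simp]: "mone n \<in> Dr n I I"
  by (rule DrI[OF mone_Zr]) (auto simp: mone_def)

lemma embr_mone [simp]:
  assumes "I \<subseteq> {1..n}" "card I = m"
  shows "embr n I I (mone m) (mone (n - m)) = mone n"
  using embr_blkr[OF assms(1) assms(1) mone_Dr] unfolding blkr_mone'[OF assms] .

section \<open>Invertible block matrices and their inverses\<close>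

lemma embr_GL [simp]:
  fixes a b :: "('a::field) mat"
  assumes "I \<subseteq> {1..n}" "card I = m" "J \<subseteq> {1..n}" "card J = m"
    and "a \<in> GL m" "b \<in> GL (n - m)"
  shows "embr n I J a b \<in> GL n"
  using assms
  by (intro GL_I[of _ _ "embr n J I (minv m a) (minv (n - m) b)"]) (simp_all add: embr_mmult[where m = m])

lemma minv_embr:
  fixes a b :: "('a::field) mat"
  assumes "I \<subseteq> {1..n}" "card I = m" "J \<subseteq> {1..n}" "card J = m"
    and "a \<in> GL m" "b \<in> GL (n - m)"
  shows "minv n (embr n I J a b) = embr n J I (minv m a) (minv (n - m) b)"
  using assms by (intro minv_unique) (simp_all add: embr_mmult[where m = m])

text \<open>The block permutation matrix \<^term>\<open>embr n J I (mone m) (mone (n - m))\<close> reduces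
  statements about \<^term>\<open>Zr n I J\<close> with different index sets to the square case.\<close>

lemma minv_Zr:
  fixes g :: "('a::{finite,field}) mat"
  assumes IJ: "I \<subseteq> {1..n}" "card I = m" "J \<subseteq> {1..n}" "card J = m"
    and g: "g \<in> GL n" "g \<in> Zr n I J"
  shows "minv n g \<in> Zr n J I"
proof -
  define w :: "'a mat" where "w = embr n J I (mone m) (mone (n - m))"
  have w: "w \<in> GL n" "w \<in> Zr n J I" using IJ by (simp_all add: w_def)
  \<comment> \<open>The product g w is square block triangular, so \<open>minv_closed\<close>
    applies to it; the inverse of \<open>g\<close> is then w (g w)^(-1).\<close>
  have "minv n (mmult n g w) \<in> GL n \<inter> Zr n I I"
    using g w by (intro minv_closed) (auto intro: Zr_mmult)
  then have "mmult n w (minv n (mmult n g w)) \<in> Zr n J I" using w(2) by (auto intro: Zr_mmult)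
  then show ?thesis using g w by (simp add: minv_mult)
qed

text \<open>Both \<open>g\<close> and its inverse are block triangular, and taking diagonal blocks
  is multiplicative on such matrices, so the blocks are inverse to each other.\<close>

lemma blkr_GL:
  fixes g :: "('a::{finite,field}) mat"
  assumes IJ: "I \<subseteq> {1..n}" "card I = m" "J \<subseteq> {1..n}" "card J = m"
    and g: "g \<in> GL n" "g \<in> Zr n I J"
  shows "blkr I J g \<in> GL m" "cblkr n I J g \<in> GL (n - m)"
    and "blkr J I (minv n g) = minv m (blkr I J g)"
    and "cblkr n J I (minv n g) = minv (n - m) (cblkr n I J g)"
proof -
  have h: "minv n g \<in> Zr n J I" using minv_Zr[OF IJ g] .
  note r1 = blkr_mmult_Zr[OF IJ(1-4) IJ(1,2) g(2) h]
  note r2 = blkr_mmult_Zr[OF IJ(3,4) IJ(1-2) IJ(3,4) h g(2)]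
  have e: "mmult m (blkr I J g) (blkr J I (minv n g)) = mone m"
    "mmult m (blkr J I (minv n g)) (blkr I J g) = mone m"
    "mmult (n - m) (cblkr n I J g) (cblkr n J I (minv n g)) = mone (n - m)"
    "mmult (n - m) (cblkr n J I (minv n g)) (cblkr n I J g) = mone (n - m)"
    using r1 r2 IJ g by simp_all
  show G: "blkr I J g \<in> GL m" "cblkr n I J g \<in> GL (n - m)"
    using IJ by (intro GL_I[OF _ _ e(1,2)] GL_I[OF _ _ e(3,4)]; simp)+
  show "blkr J I (minv n g) = minv m (blkr I J g)"
    using minv_unique[OF G(1) _ e(1)] IJ by simp
  show "cblkr n J I (minv n g) = minv (n - m) (cblkr n I J g)"
    using minv_unique[OF G(2) _ e(3)] IJ by simp
qed

subsection \<open>Block triangular groups\<close>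

text \<open>The fibre of the projection to the two diagonal blocks. Deflation sums over such fibres,
  and since no group membership is built in, conjugation carries fibres to fibres without side
  conditions to track.\<close>

definition fibre :: "nat \<Rightarrow> nat set \<Rightarrow> ('a::zero) mat \<Rightarrow> 'a mat \<Rightarrow> 'a mat set" where
  "fibre n I a b = {g \<in> Zr n I I. blkr I I g = a \<and> cblkr n I I g = b}"

lemma fibre_Zr: "g \<in> fibre n I a b \<Longrightarrow> g \<in> Zr n I I"
  by (simp add: fibre_def)

lemma fibre_matn: "g \<in> fibre n I a b \<Longrightarrow> g \<in> matn n"
  by (rule Zr_matn[OF fibre_Zr])

lemma finite_fibre [simp]: "finite (fibre n I a b :: 'a::{finite,zero} mat set)"
  by (rule finite_subset[OF _ finite_matn[of n]]) (auto dest: fibre_matn)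

lemma fibre_mmult:
  fixes g h :: "('a::comm_ring_1) mat"
  assumes "I \<subseteq> {1..n}" "card I = m" "g \<in> fibre n I a b" "h \<in> fibre n I a' b'"
  shows "mmult n g h \<in> fibre n I (mmult m a a') (mmult (n - m) b b')"
proof -
  have g: "g \<in> Zr n I I" "blkr I I g = a" "cblkr n I I g = b"
    and h: "h \<in> Zr n I I" "blkr I I h = a'" "cblkr n I I h = b'"
    using assms(3,4) unfolding fibre_def by blast+
  show ?thesis
    using blkr_mmult_Zr[OF assms(1,2,1,2,1,2) g(1) h(1)] Zr_mmult[OF g(1) h(1)]
    unfolding fibre_def g(2,3) h(2,3) by blast
qed

lemma embr_fibre:
  "I \<subseteq> {1..n} \<Longrightarrow> card I = m \<Longrightarrow> a \<in> matn m \<Longrightarrow> b \<in> matn (n - m) \<Longrightarrow> embr n I I a b \<in> fibre n I a b"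
  by (simp add: fibre_def)

lemma blkr_entry:
  "finite I \<Longrightarrow> finite J \<Longrightarrow> i \<in> I \<Longrightarrow> j \<in> J \<Longrightarrow> blkr I J g (cano I i) (cano J j) = g i j"
  using cano_range[of I i] cano_range[of J j] by (simp add: blkr_def)

lemma blkr_cong:
  assumes "finite I" "finite J" "\<And>i j. i \<in> I \<Longrightarrow> j \<in> J \<Longrightarrow> g i j = h i j"
  shows "blkr I J g = blkr I J h"
  using assms cano_inv_in[OF assms(1)] cano_inv_in[OF assms(2)] unfolding blkr_def fun_eq_iff
  by (simp del: atLeastAtMost_iff)

text \<open>Bridge to \<open>UR\<close> and \<open>Rv\<close>, which are described by the positions
  where a matrix may differ from the identity.\<close>

lemma fibre_mone_iff:
  fixes g :: "('a::comm_ring_1) mat"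
  assumes I: "I \<subseteq> {1..n}" "card I = m"
  shows "g \<in> fibre n I (mone m) (mone (n - m)) \<longleftrightarrow>
    g \<in> matn n \<and> (\<forall>i j. g i j \<noteq> mone n i j \<longrightarrow> i \<in> I \<and> j \<in> {1..n} - I)" (is "?l \<longleftrightarrow> ?r")
proof
  have fin: "finite I" "finite ({1..n} - I)" using I subset_interval_finite by auto
  have mone_off: "mone n i j = (0::'a)" if "i \<in> I \<longleftrightarrow> j \<notin> I" for i j
    using that by (auto simp: mone_def)
  {
    assume g: ?l
    have b: "blkr I I g = blkr I I (mone n)" "cblkr n I I g = cblkr n I I (mone n)"
      using g unfolding blkr_mone'[OF I] by (simp_all add: fibre_def)
    have "g i j = mone n i j" if off: "\<not> (i \<in> I \<and> j \<in> {1..n} - I)" for i j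
    proof -
      consider "i \<in> I" "j \<in> I" | "i \<in> {1..n} - I" "j \<in> {1..n} - I" | "i \<notin> {1..n} \<or> j \<notin> {1..n}"
        | "i \<notin> I" "j \<in> I"
        using off by blast
      then show ?thesis
      proof cases
        case 1
        then show ?thesis using b(1) blkr_entry[OF fin(1) fin(1)] by metis
      next
        case 2
        then show ?thesis using b(2) blkr_entry[OF fin(2) fin(2)] unfolding cblkr_def by metis
      next
        case 3
        have "g \<in> matn n" using g by (rule fibre_matn)
        then show ?thesis using 3 mone_matn[of n] unfolding matn_def by auto
      next
        case 4
        then show ?thesis using Zr_zero[OF fibre_Zr[OF g], of i j] mone_off[of i j] by simp
      qed
    qed
    then show ?r using fibre_matn[OF g] by (auto simp del: atLeastAtMost_iff)
  next
    assume r: ?r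
    have e: "g i j = mone n i j" if "\<not> (i \<in> I \<and> j \<in> {1..n} - I)" for i j
      using r that by blast
    have "g \<in> Zr n I I"
    proof (rule ZrI)
      show "g i j = 0" if "i \<in> {1..n} - I" "j \<in> I" for i j
        using e[of i j] mone_off[of i j] that by (metis DiffD2)
    qed (use r in blast)
    moreover have "blkr I I g = blkr I I (mone n)"
      using e fin by (intro blkr_cong) blast+
    moreover have "cblkr n I I g = cblkr n I I (mone n)"
      using e fin unfolding cblkr_def by (intro blkr_cong) blast+
    ultimately show ?l unfolding fibre_def blkr_mone'[OF I] by simp
  }
qed

text \<open>Common frame for both Hopf algebras: \<open>K\<close> with Levi part \<open>L\<close>
  and radical \<open>R\<close> will be \<open>UP n I\<close> with \<open>UL n I\<close> and
  \<open>UR n I\<close>, or \<open>Pv n i\<close> with \<open>Lv n i\<close> and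
  \<open>Rv n i\<close>.\<close>

locale block_group =
  fixes n m :: nat and I :: "nat set" and GA GB K L R :: "('a::{finite,field}) mat set"
  assumes I: "I \<subseteq> {1..n}" "card I = m"
    and GA: "GA \<subseteq> GL m" and GB: "GB \<subseteq> GL (n - m)"
    and K_GL: "K \<subseteq> GL n" and K_Zr: "K \<subseteq> Zr n I I"
    and K_mmult: "\<And>g h. g \<in> K \<Longrightarrow> h \<in> K \<Longrightarrow> mmult n g h \<in> K"
    and K_blocks: "\<And>g. g \<in> K \<Longrightarrow> blkr I I g \<in> GA \<and> cblkr n I I g \<in> GB"
    and L_eq: "L = {embr n I I a b | a b. a \<in> GA \<and> b \<in> GB}"
    and L_K: "L \<subseteq> K"
    and R_eq: "R = fibre n I (mone m) (mone (n - m)) \<inter> K"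
begin

lemma embr_in:
  assumes "a \<in> GA" "b \<in> GB"
  shows "embr n I I a b \<in> L" "embr n I I a b \<in> K" "embr n I I a b \<in> GL n"
    "embr n I I a b \<in> fibre n I a b"
proof -
  show "embr n I I a b \<in> L" using assms L_eq by blast
  then show "embr n I I a b \<in> K" using L_K by blast
  then show "embr n I I a b \<in> GL n" using K_GL by blast
  have "a \<in> matn m" "b \<in> matn (n - m)" using assms GA GB GL_matn by blast+
  then show "embr n I I a b \<in> fibre n I a b" using I embr_fibre by blast
qed

lemma K_minv:
  assumes "g \<in> K"
  shows "minv n g \<in> K"
proof -
  \<comment> \<open>\<open>minv_closed\<close> requires the identity, so it is adjoined to
    \<open>K\<close> first. If the inverse of \<open>g\<close> is the identity, then so is
    \<open>g\<close>, and the identity lies in \<open>K\<close> after all.\<close>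
  have "insert (mone n) K \<subseteq> GL n" using K_GL by simp
  moreover have "mmult n A B \<in> insert (mone n) K"
    if "A \<in> insert (mone n) K" "B \<in> insert (mone n) K" for A B
    using that K_mmult K_Zr by (auto dest: subsetD intro: Zr_matn)
  ultimately have "minv n g \<in> insert (mone n) K"
    using assms by (intro minv_closed) auto
  moreover have "mone n \<in> K" if "minv n g = mone n"
    using minv_minv[of g n] that assms K_GL by (metis minv_mone subsetD)
  ultimately show ?thesis by (metis insertE)
qed

text \<open>Existence half of \<open>K = L R\<close>: dividing by the block diagonal part leaves
  identity blocks on the diagonal.\<close>

lemma embr_R:
  assumes ab: "a \<in> GA" "b \<in> GB" and g: "g \<in> fibre n I a b \<inter> K"
  shows "mmult n (minv n (embr n I I a b)) g \<in> R"
proof -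
  have G: "a \<in> GL m" "b \<in> GL (n - m)" using ab GA GB by blast+
  have "minv n (embr n I I a b) \<in> fibre n I (minv m a) (minv (n - m) b)"
    unfolding minv_embr[OF I I G] using G by (intro embr_fibre[OF I]) auto
  then have "mmult n (minv n (embr n I I a b)) g \<in> fibre n I (mmult m (minv m a) a) (mmult (n - m) (minv (n - m) b) b)"
    using g by (intro fibre_mmult[OF I]) auto
  moreover have "mmult n (minv n (embr n I I a b)) g \<in> K"
    using g ab by (intro K_mmult K_minv embr_in) auto
  ultimately show ?thesis using G by (simp add: R_eq)
qed

text \<open>The coset of \<open>R\<close> through a block diagonal matrix is a whole fibre inside
  \<open>K\<close>. This turns the averages in \<open>Def\<close> into sums over fibres.\<close>

lemma bij_betw_R:
  assumes ab: "a \<in> GA" "b \<in> GB"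
  shows "bij_betw (mmult n (embr n I I a b)) R (fibre n I a b \<inter> K)"
proof (rule bij_betw_byWitness[where f' = "mmult n (minv n (embr n I I a b))"])
  have G: "a \<in> GL m" "b \<in> GL (n - m)" using ab GA GB by blast+
  have sub: "x \<in> matn n" if "x \<in> R \<or> x \<in> fibre n I a b \<inter> K" for x
    using that by (auto simp: R_eq intro: fibre_matn)
  show "\<forall>x\<in>R. mmult n (minv n (embr n I I a b)) (mmult n (embr n I I a b) x) = x"
    using embr_in(3)[OF ab] sub by auto
  show "\<forall>x\<in>fibre n I a b \<inter> K. mmult n (embr n I I a b) (mmult n (minv n (embr n I I a b)) x) = x"
    using embr_in(3)[OF ab] sub by auto
  show "mmult n (embr n I I a b) ` R \<subseteq> fibre n I a b \<inter> K"
  proof (rule image_subsetI)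
    fix x assume "x \<in> R"
    then have x: "x \<in> fibre n I (mone m) (mone (n - m))" "x \<in> K" by (auto simp: R_eq)
    then show "mmult n (embr n I I a b) x \<in> fibre n I a b \<inter> K"
      using fibre_mmult[OF I embr_in(4)[OF ab] x(1)] K_mmult[OF embr_in(2)[OF ab] x(2)] G by simp
  qed
  show "mmult n (minv n (embr n I I a b)) ` (fibre n I a b \<inter> K) \<subseteq> R"
    using embr_R[OF ab] by blast
qed

lemma sum_R:
  assumes ab: "a \<in> GA" "b \<in> GB"
  shows "(\<Sum>r\<in>R. f (mmult n (embr n I I a b) r)) = sum f (fibre n I a b \<inter> K)"
  by (rule sum.reindex_bij_betw[OF bij_betw_R[OF ab]])

lemma card_fibre:
  assumes ab: "a \<in> GA" "b \<in> GB"
  shows "card (fibre n I a b \<inter> K) = card R"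
  using bij_betw_same_card[OF bij_betw_R[OF ab]] by simp

lemma finite_sets: "finite GA" "finite GB" "finite K" "finite R"
  using GA GB K_GL finite_GL finite_subset[of R K] R_eq by (auto intro: finite_subset)

text \<open>Group \<open>K\<close> by diagonal blocks; each fibre over \<open>GA \<times> GB\<close>
  has \<open>card R\<close> elements.\<close>

lemma sum_K:
  fixes f :: "'a mat \<times> 'a mat \<Rightarrow> complex"
  shows "(\<Sum>g\<in>K. f (blkr I I g, cblkr n I I g)) = of_nat (card R) * (\<Sum>a\<in>GA. \<Sum>b\<in>GB. f (a, b))"
proof -
  have "(\<Sum>g\<in>K. f (blkr I I g, cblkr n I I g))
      = (\<Sum>ab\<in>GA \<times> GB. \<Sum>g\<in>{g \<in> K. (blkr I I g, cblkr n I I g) = ab}. f (blkr I I g, cblkr n I I g))"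
    using finite_sets K_blocks by (intro sum.group[symmetric]) auto
  also have "\<dots> = (\<Sum>ab\<in>GA \<times> GB. of_nat (card R) * f ab)"
  proof (intro sum.cong refl)
    fix ab assume "ab \<in> GA \<times> GB"
    then obtain a b where ab: "ab = (a, b)" "a \<in> GA" "b \<in> GB" by blast
    have e: "{g \<in> K. (blkr I I g, cblkr n I I g) = ab} = fibre n I a b \<inter> K"
      using K_Zr ab(1) by (auto simp: fibre_def)
    have "(\<Sum>g\<in>fibre n I a b \<inter> K. f (blkr I I g, cblkr n I I g)) = (\<Sum>g\<in>fibre n I a b \<inter> K. f ab)"
      using ab(1) by (intro sum.cong) (auto simp: fibre_def)
    then show "(\<Sum>g\<in>{g \<in> K. (blkr I I g, cblkr n I I g) = ab}. f (blkr I I g, cblkr n I I g))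
        = of_nat (card R) * f ab"
      unfolding e using card_fibre[OF ab(2,3)] by simp
  qed
  also have "\<dots> = of_nat (card R) * (\<Sum>a\<in>GA. \<Sum>b\<in>GB. f (a, b))"
    by (simp add: sum_distrib_left sum.cartesian_product)
  finally show ?thesis .
qed

lemma card_K: "card K = card GA * card GB * card R"
proof -
  have "of_nat (card K) = (of_nat (card GA * card GB * card R) :: complex)"
    using sum_K[of "\<lambda>_. 1"] by simp
  then show ?thesis by (simp only: of_nat_eq_iff)
qed

text \<open>The \<open>THE\<close> in \<open>Inf\<close> selects the block diagonal matrix with the
  same diagonal blocks as \<open>g\<close>, so inflation just reads off these blocks.\<close>

lemma Inf_st_inv:
  "Inf n K L R (st_inv L n I F) = (\<lambda>g. if g \<in> K then F (blkr I I g, cblkr n I I g) else 0)"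
proof
  fix g
  show "Inf n K L R (st_inv L n I F) g = (if g \<in> K then F (blkr I I g, cblkr n I I g) else 0)"
  proof (cases "g \<in> K")
    case True
    define a b where "a = blkr I I g" and "b = cblkr n I I g"
    have ab: "a \<in> GA" "b \<in> GB" using K_blocks True by (auto simp: a_def b_def)
    have g: "g \<in> fibre n I a b \<inter> K" using True K_Zr by (auto simp: fibre_def a_def b_def)
    have "(THE l. l \<in> L \<and> (\<exists>r\<in>R. g = mmult n l r)) = embr n I I a b"
    proof (rule the_equality)
      have "g = mmult n (embr n I I a b) (mmult n (minv n (embr n I I a b)) g)"
        using embr_in(3)[OF ab] True K_GL by auto
      then show "embr n I I a b \<in> L \<and> (\<exists>r\<in>R. g = mmult n (embr n I I a b) r)"
        using embr_in(1)[OF ab] embr_R[OF ab g] by blast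
    next
      \<comment> \<open>Uniqueness: multiplying by an element of \<open>R\<close> does not change
        the diagonal blocks, so \<open>l\<close> has those of \<open>g\<close>.\<close>
      fix l assume "l \<in> L \<and> (\<exists>r\<in>R. g = mmult n l r)"
      then obtain r a' b' where r: "r \<in> R" "g = mmult n l r"
        and l: "l = embr n I I a' b'" "a' \<in> GA" "b' \<in> GB" using L_eq by blast
      have "g \<in> fibre n I a' b'"
        using bij_betwE[OF bij_betw_R[OF l(2,3)]] r l(1) by blast
      then show "l = embr n I I a b" using l(1) by (simp add: fibre_def a_def b_def)
    qed
    moreover have "blk I (embr n I I a b) = a" "blk ({1..n} - I) (embr n I I a b) = b"
      using embr_in(4)[OF ab] by (simp_all add: fibre_def blk_eq_blkr cblkr_def)
    ultimately show ?thesis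
      using True embr_in(1)[OF ab] unfolding Inf_def st_inv_def a_def[symmetric] b_def[symmetric] by simp
  qed (simp add: Inf_def)
qed

end

section \<open>The unitriangular and parabolic instances of block triangular groups\<close>

lemma cano_inv_less_iff:
  assumes "finite I" "r \<in> {1..card I}" "s \<in> {1..card I}"
  shows "cano_inv I r < cano_inv I s \<longleftrightarrow> r < s"
  using cano_less_iff[OF assms(1)] cano_inv_in[OF assms(1)] cano_cano_inv[OF assms(1)] assms(2,3)
  by metis

lemma UTI:
  "g \<in> matn n \<Longrightarrow> (\<And>i j. i \<in> {1..n} \<Longrightarrow> j \<in> {1..n} \<Longrightarrow> j < i \<Longrightarrow> g i j = 0) \<Longrightarrow>
   (\<And>i. i \<in> {1..n} \<Longrightarrow> g i i = 1) \<Longrightarrow> g \<in> UT n"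
  unfolding UT_def by blast

lemma blkr_UT:
  assumes g: "g \<in> UT n" and I: "I \<subseteq> {1..n}" "card I = m"
  shows "blkr I I g \<in> UT m"
proof (rule UTI)
  have fin: "finite I" using I subset_interval_finite by blast
  show "blkr I I g r s = 0" if "r \<in> {1..m}" "s \<in> {1..m}" "s < r" for r s
    using UT_lower[OF g, of "cano_inv I s" "cano_inv I r"] cano_inv_less_iff[OF fin, of s r] that I(2)
    by (simp add: blkr_def)
  show "blkr I I g r r = 1" if "r \<in> {1..m}" for r
    using UT_diag[OF g, of "cano_inv I r"] cano_inv_in[OF fin, of r] that I
    unfolding blkr_def by auto
qed (use I in simp)

lemma cblkr_UT:
  assumes g: "g \<in> UT n" and I: "I \<subseteq> {1..n}" "card I = m"
  shows "cblkr n I I g \<in> UT (n - m)"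
  unfolding cblkr_def by (rule blkr_UT[OF g _ card_Diff_interval[OF I]]) blast

lemma embr_UT:
  assumes I: "I \<subseteq> {1..n}" "card I = m" and ab: "a \<in> UT m" "b \<in> UT (n - m)"
  shows "embr n I I a b \<in> UT n"
proof (rule UTI)
  have fin: "finite I" "finite ({1..n} - I)" using I subset_interval_finite by auto
  have c: "card ({1..n} - I) = n - m" using card_Diff_interval[OF I] .
  show "embr n I I a b i j = 0" if "i \<in> {1..n}" "j \<in> {1..n}" "j < i" for i j
    using that cano_less_iff[OF fin(1), of j i] cano_less_iff[OF fin(2), of j i]
      UT_lower[OF ab(1), of "cano I j" "cano I i"]
      UT_lower[OF ab(2), of "cano ({1..n} - I) j" "cano ({1..n} - I) i"]
    unfolding embr_def by (simp del: atLeastAtMost_iff)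
  show "embr n I I a b i i = 1" if "i \<in> {1..n}" for i
    using that UT_diag[OF ab(1), of "cano I i"] UT_diag[OF ab(2), of "cano ({1..n} - I) i"]
      cano_range[OF fin(1), of i] cano_range[OF fin(2), of i] c I(2)
    unfolding embr_def by (simp del: atLeastAtMost_iff)
qed (use I in simp)

lemma UP_eq: "I \<subseteq> {1..n} \<Longrightarrow> UP n I = UT n \<inter> (Zr n I I :: ('a::field) mat set)"
proof -
  assume I: "I \<subseteq> {1..n}"
  have "mone n i j = (0 :: 'a)" if "i \<in> {1..n} - I" "j \<in> I" for i j
    using that by (auto simp: mone_def)
  then show ?thesis unfolding UP_def Zr_def using UT_matn by (auto simp del: atLeastAtMost_iff)
qed

lemma UR_eq:
  assumes I: "I \<subseteq> {1..n}" "card I = m"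
  shows "UR n I = fibre n I (mone m) (mone (n - m) :: ('a::field) mat) \<inter> UP n I"
proof -
  have "g \<in> UR n I \<longleftrightarrow> g \<in> UT n \<and> g \<in> fibre n I (mone m) (mone (n - m))" for g :: "'a mat"
    unfolding UR_def fibre_mone_iff[OF I] using UT_matn[of g n] by blast
  then show ?thesis
    unfolding UP_eq[OF I(1)] using fibre_Zr[of _ n I "mone m :: 'a mat" "mone (n - m)"] by blast
qed

lemma UL_eq:
  assumes I: "I \<subseteq> {1..n}" "card I = m"
  shows "UL n I = {embr n I I a b | a b. a \<in> UT m \<and> b \<in> UT (n - m)}"
proof (intro equalityI subsetI)
  fix g assume g: "g \<in> UL n I"
  have off: "g i j = 0" if "i \<in> I \<longleftrightarrow> j \<notin> I" for i j
    using g that unfolding UL_def by (cases "g i j = mone n i j") (auto simp: mone_def)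
  have gU: "g \<in> UT n" using g by (simp add: UL_def)
  then have "g \<in> Dr n I I" using off by (intro DrI ZrI) auto
  then have "embr n I I (blkr I I g) (cblkr n I I g) = g" using I by (intro embr_blkr)
  then have "g = embr n I I (blkr I I g) (cblkr n I I g)" by (rule sym)
  then show "g \<in> {embr n I I a b | a b. a \<in> UT m \<and> b \<in> UT (n - m)}"
    using blkr_UT[OF gU I] cblkr_UT[OF gU I] by blast
next
  fix g assume "g \<in> {embr n I I a b | a b. a \<in> UT m \<and> b \<in> UT (n - m)}"
  then obtain a b where g: "g = embr n I I a b" "a \<in> UT m" "b \<in> UT (n - m)" by blast
  have "g i j = mone n i j" if "\<not> (i \<in> I \<and> j \<in> I)" "\<not> (i \<in> {1..n} - I \<and> j \<in> {1..n} - I)" for i j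
  proof -
    have "g i j = 0" using that unfolding g(1) embr_def by auto
    moreover have "mone n i j = 0" using that by (auto simp: mone_def)
    ultimately show ?thesis by simp
  qed
  then show "g \<in> UL n I" using embr_UT[OF I g(2,3)] unfolding UL_def g(1) by blast
qed

lemma UP_block_group:
  assumes I: "I \<subseteq> {1..n}" "card I = m"
  shows "block_group n m I (UT m) (UT (n - m)) (UP n I) (UL n I) (UR n I :: ('a::{finite,field}) mat set)"
proof
  show "I \<subseteq> {1..n}" "card I = m" by (fact I)+
  show "UT m \<subseteq> (GL m :: 'a mat set)" "UT (n - m) \<subseteq> (GL (n - m) :: 'a mat set)" by auto
  show "UP n I \<subseteq> (GL n :: 'a mat set)" "UP n I \<subseteq> (Zr n I I :: 'a mat set)"
    using I by (auto simp: UP_eq)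
  show "mmult n g h \<in> UP n I" if "g \<in> UP n I" "h \<in> UP n I" for g h :: "'a mat"
    using that I by (auto simp: UP_eq intro: Zr_mmult)
  show "blkr I I g \<in> UT m \<and> cblkr n I I g \<in> UT (n - m)" if "g \<in> UP n I" for g :: "'a mat"
    using that I blkr_UT cblkr_UT unfolding UP_eq[OF I(1)] by blast
  show "UL n I = {embr n I I a b | a b. a \<in> (UT m :: 'a mat set) \<and> b \<in> UT (n - m)}"
    by (rule UL_eq[OF I])
  show "UL n I \<subseteq> (UP n I :: 'a mat set)"
    unfolding UL_eq[OF I] UP_eq[OF I(1)] using embr_UT[OF I] embr_Zr[OF I(1) I(1)] by blast
  show "UR n I = fibre n I (mone m) (mone (n - m)) \<inter> (UP n I :: 'a mat set)"
    by (rule UR_eq[OF I])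
qed

text \<open>For an initial segment the positions forced to vanish all lie below the
  diagonal.\<close>

lemma UP_interval: "i \<le> n \<Longrightarrow> UP n {1..i} = UT n"
proof -
  assume "i \<le> n"
  then have "UT n \<subseteq> Zr n {1..i} {1..i}"
    by (intro subsetI ZrI) (auto intro: UT_lower)
  then show ?thesis using UP_eq[of "{1..i}" n] \<open>i \<le> n\<close> by auto
qed

lemma Pv_eq: "Pv n i = GL n \<inter> Zr n {1..i} {1..i}"
  unfolding Pv_def Zr_def using GL_matn by blast

text \<open>For an initial segment the positions that may differ from the identity lie strictly
  above the diagonal.\<close>

lemma fibre_mone_UT:
  assumes "i \<le> n"
  shows "fibre n {1..i} (mone i) (mone (n - i)) \<subseteq> UT n"
proof
  fix g :: "'a mat" assume "g \<in> fibre n {1..i} (mone i) (mone (n - i))"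
  then have g: "g \<in> matn n" "\<And>r s. g r s \<noteq> mone n r s \<Longrightarrow> r \<in> {1..i} \<and> s \<in> {1..n} - {1..i}"
    using fibre_mone_iff[of "{1..i}" n i g] assms by auto
  have "g r s = mone n r s" if "s \<le> r" for r s
    by (rule ccontr) (use g(2)[of r s] that in auto)
  then show "g \<in> UT n" using g(1) by (intro UTI) (auto simp: mone_def)
qed

text \<open>Both sides have the same radical for an initial segment; its order then cancels from the
  normalising constants of the two products.\<close>

lemma Rv_eq:
  assumes "i \<le> n"
  shows "Rv n i = fibre n {1..i} (mone i) (mone (n - i) :: ('a::{finite,field}) mat)"
    "Rv n i = (UR n {1..i} :: 'a mat set)"
proof -
  have I: "{1..i} \<subseteq> {1..n}" "card {1..i} = i" using assms by auto
  show R: "Rv n i = fibre n {1..i} (mone i) (mone (n - i) :: ('a::{finite,field}) mat)"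
    unfolding Rv_def using fibre_mone_iff[OF I] fibre_mone_UT[OF assms] UT_GL GL_matn by blast
  show "Rv n i = (UR n {1..i} :: 'a mat set)"
    unfolding UR_eq[OF I] UP_interval[OF assms] R using fibre_mone_UT[OF assms] by blast
qed

lemma Lv_eq:
  assumes "i \<le> n"
  shows "Lv n i = {embr n {1..i} {1..i} a b | a b. a \<in> GL i \<and> b \<in> (GL (n - i) :: ('a::{finite,field}) mat set)}"
proof (intro equalityI subsetI)
  have I: "{1..i} \<subseteq> {1..n}" "card {1..i} = i" using assms by auto
  fix g :: "'a mat" assume g: "g \<in> Lv n i"
  have gG: "g \<in> GL n" using g by (simp add: Lv_def)
  then have gD: "g \<in> Dr n {1..i} {1..i}" using g unfolding Lv_def by (intro DrI ZrI) (simp, blast+)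
  then have "embr n {1..i} {1..i} (blkr {1..i} {1..i} g) (cblkr n {1..i} {1..i} g) = g"
    using I by (intro embr_blkr)
  then have "g = embr n {1..i} {1..i} (blkr {1..i} {1..i} g) (cblkr n {1..i} {1..i} g)" by (rule sym)
  then show "g \<in> {embr n {1..i} {1..i} a b | a b. a \<in> GL i \<and> b \<in> GL (n - i)}"
    using blkr_GL(1,2)[OF I I gG Dr_Zr[OF gD]] by blast
next
  have I: "{1..i} \<subseteq> {1..n}" "card {1..i} = i" using assms by auto
  fix g :: "'a mat" assume "g \<in> {embr n {1..i} {1..i} a b | a b. a \<in> GL i \<and> b \<in> GL (n - i)}"
  then obtain a b where g: "g = embr n {1..i} {1..i} a b" "a \<in> GL i" "b \<in> GL (n - i)" by blast
  show "g \<in> Lv n i" using embr_GL[OF I I g(2,3)] unfolding Lv_def g(1)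
    unfolding embr_def by (auto simp del: atLeastAtMost_iff)
qed

lemma Pv_block_group:
  assumes i: "i \<le> n"
  shows "block_group n i {1..i} (GL i) (GL (n - i)) (Pv n i) (Lv n i) (Rv n i :: ('a::{finite,field}) mat set)"
proof
  show I: "{1..i} \<subseteq> {1..n}" "card {1..i} = i" using i by auto
  show "mmult n g h \<in> Pv n i" if "g \<in> Pv n i" "h \<in> Pv n i" for g h :: "'a mat"
    using that by (auto simp: Pv_eq intro: Zr_mmult)
  show "blkr {1..i} {1..i} g \<in> GL i \<and> cblkr n {1..i} {1..i} g \<in> GL (n - i)" if "g \<in> Pv n i" for g :: "'a mat"
    using that blkr_GL(1,2)[OF I I] unfolding Pv_eq by blast
  show "Lv n i = {embr n {1..i} {1..i} a b | a b. a \<in> (GL i :: 'a mat set) \<and> b \<in> GL (n - i)}"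
    by (rule Lv_eq[OF i])
  show "Lv n i \<subseteq> (Pv n i :: 'a mat set)"
    unfolding Lv_eq[OF i] Pv_eq using embr_GL[OF I I] embr_Zr[OF I(1) I(1)] by blast
  show "Rv n i = fibre n {1..i} (mone i) (mone (n - i)) \<inter> (Pv n i :: 'a mat set)"
    unfolding Rv_eq(1)[OF i] Pv_eq using fibre_mone_UT[OF i] fibre_Zr UT_GL by blast
qed (simp_all add: Pv_eq)

subsection \<open>Bruhat decomposition\<close>

text \<open>Pigeonhole over a finite field with q elements: there are q^|J| coefficient vectors but
  only q^|S| values, so two vectors have the same image and their difference is a nontrivial
  relation.\<close>

lemma more_columns_than_rows:
  fixes y :: "nat \<Rightarrow> nat \<Rightarrow> 'a::{finite,field}"
  assumes fin: "finite S" "finite J" and less: "card S < card J"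
  shows "\<exists>d. (\<exists>s\<in>J. d s \<noteq> 0) \<and> (\<forall>r\<in>S. (\<Sum>s\<in>J. y r s * d s) = 0)"
proof -
  define h where "h = (\<lambda>c. \<lambda>r\<in>S. \<Sum>s\<in>J. y r s * c s)"
  have q: "1 < card (UNIV :: 'a set)"
    using card_mono[of UNIV "{0, 1 :: 'a}"] by simp
  have "card (PiE S (\<lambda>_. UNIV :: 'a set)) < card (PiE J (\<lambda>_. UNIV :: 'a set))"
    using fin less q by (simp add: card_PiE)
  moreover have "h ` (PiE J (\<lambda>_. UNIV)) \<subseteq> PiE S (\<lambda>_. UNIV)"
    by (auto simp: h_def)
  ultimately have "\<not> inj_on h (PiE J (\<lambda>_. UNIV))"
    using fin by (meson card_inj_on_le finite_PiE finite leD)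
  then obtain c c' where c: "c \<in> PiE J (\<lambda>_. UNIV)" "c' \<in> PiE J (\<lambda>_. UNIV)" "h c = h c'" "c \<noteq> c'"
    unfolding inj_on_def by blast
  have "\<exists>s\<in>J. c s - c' s \<noteq> 0"
    using c by (metis PiE_ext eq_iff_diff_eq_0)
  moreover have "(\<Sum>s\<in>J. y r s * (c s - c' s)) = 0" if "r \<in> S" for r
    using fun_cong[OF c(3), of r] that by (simp add: h_def right_diff_distrib sum_subtractf)
  ultimately show ?thesis by (intro exI[of _ "\<lambda>s. c s - c' s"]) blast
qed

text \<open>A unitriangular column operation turns the last column occurring in a linear relation
  into a zero column.\<close>

lemma clear_column:
  fixes y :: "'a::{finite,field} mat"
  assumes J: "J \<subseteq> {1..n}" and t: "t \<in> J" "d t \<noteq> 0" and last: "\<And>s. s \<in> J \<Longrightarrow> t < s \<Longrightarrow> d s = 0"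
    and rel: "\<And>r. r \<in> S \<Longrightarrow> (\<Sum>s\<in>J. y r s * d s) = 0" and S: "S \<subseteq> {1..n}"
  shows "\<exists>v\<in>UT n. (\<forall>r\<in>S. mmult n y v r t = 0) \<and> (\<forall>r k. k \<noteq> t \<longrightarrow> k \<in> {1..n} \<longrightarrow> r \<in> {1..n} \<longrightarrow> mmult n y v r k = y r k)"
proof -
  \<comment> \<open>The identity matrix with column \<open>t\<close> replaced by the relation,
    scaled to have entry 1 at \<open>t\<close>. Cutting at \<open>j \<le> t\<close> makes
    \<open>v\<close> upper triangular and, by \<open>last\<close>, discards only zero
    coefficients.\<close>
  define v where "v = (\<lambda>j k. if k = t then (if j \<in> J \<and> j \<le> t then d j / d t else 0) else mone n j k)"
  have tn: "t \<in> {1..n}" using t J by blast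
  have vm: "v \<in> matn n"
    using J tn mone_matn[of n, where 'a = 'a] unfolding matn_def v_def
    by (smt (verit, best) mem_Collect_eq subsetD)
  have vU: "v \<in> UT n"
    using t by (intro UTI[OF vm]) (auto simp: v_def mone_def)
  moreover have "mmult n y v r t = 0" if r: "r \<in> S" for r
  proof -
    have "mmult n y v r t = (\<Sum>j = 1..n. y r j * v j t)"
      using r S tn by (auto simp: mmult_def)
    also have "\<dots> = (\<Sum>j\<in>J. y r j * v j t)"
      using J by (intro sum.mono_neutral_right) (auto simp: v_def)
    also have "\<dots> = (\<Sum>j\<in>J. y r j * d j / d t)"
      using last by (intro sum.cong) (force simp: v_def)+
    also have "\<dots> = 0" using rel[OF r] by (simp flip: sum_divide_distrib)
    finally show ?thesis .
  qed
  moreover have "mmult n y v r k = y r k" if k: "k \<noteq> t" "k \<in> {1..n}" "r \<in> {1..n}" for r k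
  proof -
    have "mmult n y v r k = (\<Sum>j = 1..n. y r j * v j k)"
      using k by (simp add: mmult_def)
    also have "\<dots> = (\<Sum>j = 1..n. if j = k then y r j else 0)"
      using k by (intro sum.cong refl) (simp add: v_def mone_def)
    finally have "mmult n y v r k = (\<Sum>j = 1..n. if j = k then y r j else 0)" .
    then show ?thesis using k by simp
  qed
  ultimately show ?thesis by blast
qed

text \<open>Choose \<open>u\<close> so that as many columns of x u as possible vanish in the lower
  rows. With fewer than \<open>i\<close> such columns, \<open>clear_column\<close> would produce one
  more.\<close>

lemma exists_UT_Zr:
  fixes x :: "'a::{finite,field} mat"
  assumes i: "i \<le> n"
  shows "\<exists>I u. I \<subseteq> {1..n} \<and> card I = i \<and> u \<in> UT n \<and> mmult n x u \<in> Zr n {1..i} I"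
proof -
  define S where "S = {1..n} - {1..i}"
  define N where "N = (\<lambda>u. {s \<in> {1..n}. \<forall>r\<in>S. mmult n x u r s = 0})"
  have S: "S \<subseteq> {1..n}" "finite S" "card S = n - i" using i by (auto simp: S_def card_Diff_subset)
  have finN: "finite (N u)" for u by (simp add: N_def)
  obtain u where u: "u \<in> UT n" and umax: "\<And>v. v \<in> UT n \<Longrightarrow> card (N v) \<le> card (N u)"
  proof -
    have fin: "finite ((\<lambda>u. card (N u)) ` UT n)" by simp
    moreover have "UT n \<noteq> ({} :: 'a mat set)" using mone_UT by blast
    ultimately have "Max ((\<lambda>u. card (N u)) ` UT n) \<in> (\<lambda>u. card (N u)) ` UT n"
      by (intro Max_in) auto
    then obtain u where "u \<in> UT n" "card (N u) = Max ((\<lambda>u. card (N u)) ` UT n)" by auto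
    then show ?thesis using that[of u] Max_ge[OF fin] by simp
  qed
  have "i \<le> card (N u)"
  proof (rule ccontr)
    assume *: "\<not> i \<le> card (N u)"
    define J where "J = {1..n} - N u"
    have Nsub: "N u \<subseteq> {1..n}" by (auto simp: N_def)
    have J: "J \<subseteq> {1..n}" "finite J" by (auto simp: J_def)
    have "card J = n - card (N u)" unfolding J_def by (rule card_Diff_interval[OF Nsub refl])
    \<comment> \<open>More than \<open>n - i\<close> columns remain against \<open>n - i\<close>
      rows, so these columns satisfy a linear relation.\<close>
    then have "card S < card J" using * i S(3) by linarith
    then obtain d where d: "\<exists>s\<in>J. d s \<noteq> 0" "\<And>r. r \<in> S \<Longrightarrow> (\<Sum>s\<in>J. mmult n x u r s * d s) = 0"
      using more_columns_than_rows[OF S(2) J(2), of "mmult n x u"] by blast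
    define T where "T = {s \<in> J. d s \<noteq> 0}"
    have T: "finite T" "T \<noteq> {}" using d(1) J by (auto simp: T_def)
    have t: "Max T \<in> J" "d (Max T) \<noteq> 0" using Max_in[OF T] by (auto simp: T_def)
    have last: "d s = 0" if "s \<in> J" "Max T < s" for s
      using Max_ge[OF T(1), of s] that by (fastforce simp: T_def)
    have "\<exists>v\<in>UT n. (\<forall>r\<in>S. mmult n (mmult n x u) v r (Max T) = 0) \<and>
      (\<forall>r k. k \<noteq> Max T \<longrightarrow> k \<in> {1..n} \<longrightarrow> r \<in> {1..n} \<longrightarrow> mmult n (mmult n x u) v r k = mmult n x u r k)"
      using J(1) t last d(2) S(1) by (rule clear_column[where d = d])
    then obtain v where v: "v \<in> UT n" "\<And>r. r \<in> S \<Longrightarrow> mmult n (mmult n x u) v r (Max T) = 0"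
      "\<And>r k. k \<noteq> Max T \<Longrightarrow> k \<in> {1..n} \<Longrightarrow> r \<in> {1..n} \<Longrightarrow> mmult n (mmult n x u) v r k = mmult n x u r k"
      by blast
    \<comment> \<open>Column \<open>Max T\<close> has become zero on \<open>S\<close>, and all other
      columns are unchanged, so no earlier zero column is lost.\<close>
    have "insert (Max T) (N u) \<subseteq> N (mmult n u v)"
    proof
      fix k assume "k \<in> insert (Max T) (N u)"
      then show "k \<in> N (mmult n u v)"
        using v(2,3) t(1) J(1) S(1) unfolding N_def mmult_assoc[symmetric]
        by (cases "k = Max T") (auto simp del: atLeastAtMost_iff dest: subsetD)
    qed
    then have "card (insert (Max T) (N u)) \<le> card (N (mmult n u v))"
      using finN by (intro card_mono)
    moreover have "Max T \<notin> N u" using t(1) by (simp add: J_def)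
    ultimately have "card (N u) < card (N (mmult n u v))" using finN by simp
    then show False using umax[of "mmult n u v"] u v(1) by simp
  qed
  then obtain I where I: "I \<subseteq> N u" "card I = i" using obtain_subset_with_card_n by metis
  then have "mmult n x u \<in> Zr n {1..i} I"
    by (intro ZrI) (auto simp: N_def S_def)
  then show ?thesis using I u unfolding N_def by blast
qed

text \<open>The diagonal entry at an index in \<open>I\<close> but outside \<open>J\<close> would be
  both 1 and 0; equal cardinalities do the rest.\<close>

lemma UT_Zr_index:
  assumes v: "v \<in> UT n" "v \<in> Zr n J I" and IJ: "I \<subseteq> {1..n}" "finite J" "card I = card J"
  shows "I = J"
proof -
  have "I \<subseteq> J"
  proof
    fix s assume s: "s \<in> I"
    show "s \<in> J"
    proof (rule ccontr)
      assume "s \<notin> J"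
      then have "v s s = 0" using Zr_zero[OF v(2)] s by blast
      then show False using UT_diag[OF v(1)] s IJ by force
    qed
  qed
  then show ?thesis using IJ card_subset_eq by blast
qed

text \<open>The solutions \<open>u\<close> form the coset of \<open>UP n I\<close> through
  \<open>u0\<close>.\<close>

lemma card_UT_Zr:
  fixes x :: "'a::{finite,field} mat"
  assumes I: "I \<subseteq> {1..n}" "card I = i" and i: "i \<le> n" and x: "x \<in> GL n"
    and u0: "u0 \<in> UT n" "mmult n x u0 \<in> Zr n {1..i} I"
  shows "card {u \<in> UT n. mmult n x u \<in> Zr n {1..i} I} = card (UP n I :: 'a mat set)"
proof -
  have L: "{1..i} \<subseteq> {1..n}" "card {1..i} = i" using i by auto
  have inv: "minv n (mmult n x u0) \<in> Zr n I {1..i}"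
    using minv_Zr[OF L I _ u0(2)] x u0(1) by simp
  have "bij_betw (mmult n u0) (UP n I) {u \<in> UT n. mmult n x u \<in> Zr n {1..i} I}"
  proof (rule bij_betw_byWitness[where f' = "mmult n (minv n u0)"])
    show "\<forall>v\<in>UP n I. mmult n (minv n u0) (mmult n u0 v) = v"
      using u0 I by (auto simp: UP_eq)
    show "\<forall>u\<in>{u \<in> UT n. mmult n x u \<in> Zr n {1..i} I}. mmult n u0 (mmult n (minv n u0) u) = u"
      using u0 by auto
    show "mmult n u0 ` UP n I \<subseteq> {u \<in> UT n. mmult n x u \<in> Zr n {1..i} I}"
    proof (rule image_subsetI)
      fix v :: "'a mat" assume "v \<in> UP n I"
      then have v: "v \<in> UT n" "v \<in> Zr n I I" using I by (auto simp: UP_eq)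
      show "mmult n u0 v \<in> {u \<in> UT n. mmult n x u \<in> Zr n {1..i} I}"
        using Zr_mmult[OF u0(2) v(2)] u0(1) v(1) by (simp add: mmult_assoc)
    qed
    show "mmult n (minv n u0) ` {u \<in> UT n. mmult n x u \<in> Zr n {1..i} I} \<subseteq> UP n I"
    proof (rule image_subsetI)
      fix u assume "u \<in> {u \<in> UT n. mmult n x u \<in> Zr n {1..i} I}"
      then have u: "u \<in> UT n" "mmult n x u \<in> Zr n {1..i} I" by auto
      \<comment> \<open>Writing u0^(-1) u as (x u0)^(-1) (x u) passes from \<open>I\<close> to
        \<open>{1..i}\<close> and back, so it is block triangular for \<open>I\<close>.\<close>
      have "mmult n (minv n (mmult n x u0)) (mmult n x u) = mmult n (minv n u0) u"
        using x u0(1) u(1) by (simp add: minv_mult mmult_assoc)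
      then have "mmult n (minv n u0) u \<in> Zr n I I" using Zr_mmult[OF inv u(2)] by simp
      then show "mmult n (minv n u0) u \<in> UP n I" using u0(1) u(1) I by (simp add: UP_eq)
    qed
  qed
  then show ?thesis by (rule bij_betw_same_card[symmetric])
qed

lemma card_UP_pos:
  assumes "I \<subseteq> {1..n}"
  shows "card (UP n I :: ('a::{finite,field}) mat set) > 0"
proof -
  have "mone n \<in> (UP n I :: 'a mat set)" using assms by (simp add: UP_eq)
  moreover have "finite (UP n I :: 'a mat set)" using assms by (simp add: UP_eq)
  ultimately show ?thesis using card_gt_0_iff by blast
qed

text \<open>A partition of unity on \<open>GL n\<close> indexed by \<open>I\<close>: exactly one
  \<open>I\<close> admits solutions \<open>u\<close>, and by \<open>card_UT_Zr\<close> its term is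
  1.\<close>

lemma Bruhat_count:
  fixes x :: "'a::{finite,field} mat"
  assumes i: "i \<le> n" and x: "x \<in> GL n"
  shows "(\<Sum>I\<in>{I. I \<subseteq> {1..n} \<and> card I = i}.
    of_nat (card {u \<in> UT n. mmult n x u \<in> Zr n {1..i} I}) / of_nat (card (UP n I :: 'a mat set))) = (1 :: complex)"
proof -
  have L: "{1..i} \<subseteq> {1..n}" "card {1..i} = i" using i by auto
  obtain I0 u0 where I0: "I0 \<subseteq> {1..n}" "card I0 = i"
    and u0: "u0 \<in> UT n" "mmult n x u0 \<in> Zr n {1..i} I0"
    using exists_UT_Zr[OF i, of x] by blast
  have inv: "minv n (mmult n x u0) \<in> Zr n I0 {1..i}"
    using minv_Zr[OF L I0 _ u0(2)] x u0(1) by simp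
  \<comment> \<open>For two solutions, u0^(-1) u is unitriangular and lies in
    \<open>Zr n I0 I\<close>, so \<open>UT_Zr_index\<close> identifies the index sets.\<close>
  have "I = I0" if I: "I \<subseteq> {1..n}" "card I = i" and u: "u \<in> UT n" "mmult n x u \<in> Zr n {1..i} I" for I u
  proof -
    have "mmult n (minv n (mmult n x u0)) (mmult n x u) = mmult n (minv n u0) u"
      using x u0(1) u(1) by (simp add: minv_mult mmult_assoc)
    then have "mmult n (minv n u0) u \<in> Zr n I0 I" using Zr_mmult[OF inv u(2)] by simp
    then show ?thesis
      using UT_Zr_index[of "mmult n (minv n u0) u" n I0 I] u0(1) u(1) I I0 subset_interval_finite by simp
  qed
  then have "{u \<in> UT n. mmult n x u \<in> Zr n {1..i} I} = {}"
    if "I \<in> {I. I \<subseteq> {1..n} \<and> card I = i} - {I0}" for I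
    using that by blast
  then have "(\<Sum>I\<in>{I. I \<subseteq> {1..n} \<and> card I = i}.
      of_nat (card {u \<in> UT n. mmult n x u \<in> Zr n {1..i} I}) / of_nat (card (UP n I :: 'a mat set)))
    = (\<Sum>I\<in>{I0}. of_nat (card {u \<in> UT n. mmult n x u \<in> Zr n {1..i} I}) / of_nat (card (UP n I :: 'a mat set)) :: complex)"
    using I0 by (intro sum.mono_neutral_right) (simp_all del: atLeastAtMost_iff)
  also have "\<dots> = 1"
    using card_UT_Zr[OF I0 i x u0] card_UP_pos[OF I0(1), where 'a = 'a] by simp
  finally show ?thesis .
qed

text \<open>Insert \<open>Bruhat_count\<close>, replace \<open>\<Phi> x\<close> by
  \<open>\<Phi> (mmult n x u)\<close> by invariance, exchange the sums and substitute z = x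
  u.\<close>

lemma sum_GL_Bruhat:
  fixes \<Phi> :: "'a::{finite,field} mat \<Rightarrow> complex"
  assumes i: "i \<le> n" and inv: "\<And>x u. x \<in> GL n \<Longrightarrow> u \<in> UT n \<Longrightarrow> \<Phi> (mmult n x u) = \<Phi> x"
  shows "(\<Sum>x\<in>GL n. \<Phi> x) = (\<Sum>I\<in>{I. I \<subseteq> {1..n} \<and> card I = i}.
    of_nat (card (UT n :: 'a mat set)) / of_nat (card (UP n I :: 'a mat set)) * (\<Sum>z\<in>GL n \<inter> Zr n {1..i} I. \<Phi> z))"
proof -
  let ?\<I> = "{I. I \<subseteq> {1..n} \<and> card I = i}"
  let ?c = "\<lambda>I. of_nat (card (UP n I :: 'a mat set)) :: complex"
  let ?g = "\<lambda>I z. if z \<in> Zr n {1..i} I then \<Phi> z / ?c I else 0"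
  have "\<Phi> x = (\<Sum>I\<in>?\<I>. \<Sum>u\<in>UT n. ?g I (mmult n x u))" if x: "x \<in> GL n" for x
  proof -
    have "(\<Sum>u\<in>UT n. ?g I (mmult n x u))
        = of_nat (card {u \<in> UT n. mmult n x u \<in> Zr n {1..i} I}) / ?c I * \<Phi> x" for I
    proof -
      have "(\<Sum>u\<in>UT n. ?g I (mmult n x u)) = (\<Sum>u\<in>UT n. if mmult n x u \<in> Zr n {1..i} I then \<Phi> x / ?c I else 0)"
        using inv x by (intro sum.cong) auto
      also have "\<dots> = (\<Sum>u\<in>{u \<in> UT n. mmult n x u \<in> Zr n {1..i} I}. \<Phi> x / ?c I)"
        by (simp add: sum.If_cases Int_def)
      finally show ?thesis by simp
    qed
    then have "(\<Sum>I\<in>?\<I>. \<Sum>u\<in>UT n. ?g I (mmult n x u))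
        = (\<Sum>I\<in>?\<I>. of_nat (card {u \<in> UT n. mmult n x u \<in> Zr n {1..i} I}) / ?c I) * \<Phi> x"
      unfolding sum_distrib_right by (rule sum.cong[OF refl])
    then show ?thesis unfolding Bruhat_count[OF i x] by simp
  qed
  then have "(\<Sum>x\<in>GL n. \<Phi> x) = (\<Sum>x\<in>GL n. \<Sum>I\<in>?\<I>. \<Sum>u\<in>UT n. ?g I (mmult n x u))"
    by (intro sum.cong) auto
  also have "\<dots> = (\<Sum>I\<in>?\<I>. \<Sum>x\<in>GL n. \<Sum>u\<in>UT n. ?g I (mmult n x u))"
    by (rule sum.swap)
  also have "\<dots> = (\<Sum>I\<in>?\<I>. \<Sum>u\<in>UT n. \<Sum>x\<in>GL n. ?g I (mmult n x u))"
    by (intro sum.cong refl sum.swap)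
  \<comment> \<open>Right translation by \<open>u\<close> permutes \<open>GL n\<close>, so the inner
    sum no longer depends on \<open>u\<close>; the sum over \<open>u\<close> then contributes the
    factor |UT_n|.\<close>
  also have "\<dots> = (\<Sum>I\<in>?\<I>. \<Sum>u\<in>(UT n :: 'a mat set). \<Sum>z\<in>GL n. ?g I z)"
    by (intro sum.cong refl sum.reindex_bij_betw bij_GL_right UT_GL)
  also have "\<dots> = (\<Sum>I\<in>?\<I>. of_nat (card (UT n :: 'a mat set)) / ?c I * (\<Sum>z\<in>GL n \<inter> Zr n {1..i} I. \<Phi> z))"
    by (simp add: sum.If_cases Int_def flip: sum_divide_distrib)
  finally show ?thesis .
qed

subsection \<open>Conjugation on block triangular matrices\<close>

text \<open>The index sets in z^(-1) g z match up as \<open>I\<close>, \<open>J\<close>,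
  \<open>J\<close>, \<open>I\<close>, so blocks multiply, and the blocks of z^(-1) are the inverses
  of those of \<open>z\<close>.\<close>

lemma conjg_fibre:
  fixes z :: "'a::{finite,field} mat"
  assumes J: "J \<subseteq> {1..n}" "card J = m" and I: "I \<subseteq> {1..n}" "card I = m"
    and z: "z \<in> GL n" "z \<in> Zr n J I" and g: "g \<in> fibre n J a b"
  shows "conjg n z g \<in> fibre n I (conjg m (blkr J I z) a) (conjg (n - m) (cblkr n J I z) b)"
proof -
  have gZ: "g \<in> Zr n J J" and gb: "blkr J J g = a" "cblkr n J J g = b"
    using g unfolding fibre_def by blast+
  have zi: "minv n z \<in> Zr n I J" using minv_Zr[OF J I z] .
  note b1 = blkr_mmult_Zr[OF I J J zi gZ]
  have zg: "mmult n (minv n z) g \<in> Zr n I J" by (rule Zr_mmult[OF zi gZ])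
  note b2 = blkr_mmult_Zr[OF I J I zg z(2)]
  show ?thesis
    unfolding fibre_def conjg_def
    using b2 Zr_mmult[OF zg z(2)] unfolding b1 gb blkr_GL(3,4)[OF J I z] by blast
qed

lemma conjg_minv_conjg:
  assumes "x \<in> GL n" "g \<in> matn n"
  shows "conjg n (minv n x) (conjg n x g) = g" "conjg n x (conjg n (minv n x) g) = g"
  using assms by (simp_all add: conjg_conjg)

text \<open>Conjugation by \<open>z\<close> is a bijection between the two fibres; by
  \<open>conjg_fibre\<close>, conjugation by its inverse leads back.\<close>

lemma sum_fibre_conjg:
  fixes z :: "'a::{finite,field} mat"
  assumes J: "J \<subseteq> {1..n}" "card J = m" and I: "I \<subseteq> {1..n}" "card I = m"
    and z: "z \<in> GL n" "z \<in> Zr n J I" and ab: "a \<in> matn m" "b \<in> matn (n - m)"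
  shows "(\<Sum>g\<in>fibre n J a b. f (conjg n z g))
    = (\<Sum>h\<in>fibre n I (conjg m (blkr J I z) a) (conjg (n - m) (cblkr n J I z) b). f h)"
proof (rule sum.reindex_bij_betw, rule bij_betw_byWitness[where f' = "conjg n (minv n z)"])
  let ?a = "conjg m (blkr J I z) a" and ?b = "conjg (n - m) (cblkr n J I z) b"
  note G = blkr_GL[OF J I z]
  show "\<forall>g\<in>fibre n J a b. conjg n (minv n z) (conjg n z g) = g"
    using conjg_minv_conjg(1)[OF z(1)] fibre_matn by blast
  show "\<forall>g\<in>fibre n I ?a ?b. conjg n z (conjg n (minv n z) g) = g"
    using conjg_minv_conjg(2)[OF z(1)] fibre_matn by blast
  show "conjg n z ` fibre n J a b \<subseteq> fibre n I ?a ?b"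
    using conjg_fibre[OF J I z] by blast
  show "conjg n (minv n z) ` fibre n I ?a ?b \<subseteq> fibre n J a b"
  proof (rule image_subsetI)
    fix h assume "h \<in> fibre n I ?a ?b"
    from conjg_fibre[OF I J minv_GL[OF z(1)] minv_Zr[OF J I z] this]
    show "conjg n (minv n z) h \<in> fibre n J a b"
      unfolding G(3,4) conjg_minv_conjg(1)[OF G(1) ab(1)] conjg_minv_conjg(1)[OF G(2) ab(2)] .
  qed
qed

text \<open>Right multiplication by the block permutation matrix \<open>w\<close>, whose blocks are
  identities, maps \<open>Pv n i\<close> bijectively onto the domain of summation and preserves both
  blocks.\<close>

lemma sum_GL_Zr:
  fixes T :: "'a::{finite,field} mat \<times> 'a mat \<Rightarrow> complex"
  assumes i: "i \<le> n" and I: "I \<subseteq> {1..n}" "card I = i"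
  shows "(\<Sum>z\<in>GL n \<inter> Zr n {1..i} I. T (blkr {1..i} I z, cblkr n {1..i} I z))
    = of_nat (card (Rv n i :: 'a mat set)) * (\<Sum>a\<in>GL i. \<Sum>b\<in>GL (n - i). T (a, b))"
proof -
  have L: "{1..i} \<subseteq> {1..n}" "card {1..i} = i" using i by auto
  interpret P: block_group n i "{1..i}" "GL i :: 'a mat set" "GL (n - i)" "Pv n i" "Lv n i" "Rv n i"
    by (rule Pv_block_group[OF i])
  define w :: "'a mat" where "w = embr n {1..i} I (mone i) (mone (n - i))"
  have w: "w \<in> GL n" "w \<in> Zr n {1..i} I"
    unfolding w_def by (intro embr_GL[OF L I mone_GL mone_GL] embr_Zr[OF L(1) I(1)])+
  have wb: "blkr {1..i} I w = mone i" "cblkr n {1..i} I w = mone (n - i)"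
    unfolding w_def by (intro blkr_embr[OF L I] mone_matn)+
  have wi: "minv n w \<in> Zr n I {1..i}" by (rule minv_Zr[OF L I w])
  have bij: "bij_betw (\<lambda>p. mmult n p w) (Pv n i) (GL n \<inter> Zr n {1..i} I)"
  proof (rule bij_betw_byWitness[where f' = "\<lambda>z. mmult n z (minv n w)"])
    show "\<forall>p\<in>Pv n i. mmult n (mmult n p w) (minv n w) = p"
      using w(1) by (auto simp: Pv_eq mmult_assoc)
    show "\<forall>z\<in>GL n \<inter> Zr n {1..i} I. mmult n (mmult n z (minv n w)) w = z"
      using w(1) by (auto simp: mmult_assoc)
    show "(\<lambda>p. mmult n p w) ` Pv n i \<subseteq> GL n \<inter> Zr n {1..i} I"
      using w Zr_mmult[OF _ w(2)] by (auto simp: Pv_eq)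
    show "(\<lambda>z. mmult n z (minv n w)) ` (GL n \<inter> Zr n {1..i} I) \<subseteq> Pv n i"
      using w Zr_mmult[OF _ wi] by (auto simp: Pv_eq)
  qed
  have "(\<Sum>z\<in>GL n \<inter> Zr n {1..i} I. T (blkr {1..i} I z, cblkr n {1..i} I z))
      = (\<Sum>p\<in>Pv n i. T (blkr {1..i} I (mmult n p w), cblkr n {1..i} I (mmult n p w)))"
    by (rule sum.reindex_bij_betw[OF bij, symmetric])
  also have "\<dots> = (\<Sum>p\<in>Pv n i. T (blkr {1..i} {1..i} p, cblkr n {1..i} {1..i} p))"
  proof (intro sum.cong refl)
    fix p :: "'a mat" assume "p \<in> Pv n i"
    then have p: "p \<in> Zr n {1..i} {1..i}" by (simp add: Pv_eq)
    have m: "blkr {1..i} {1..i} p \<in> matn i" "cblkr n {1..i} {1..i} p \<in> matn (n - i)" using L by simp_all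
    show "T (blkr {1..i} I (mmult n p w), cblkr n {1..i} I (mmult n p w))
      = T (blkr {1..i} {1..i} p, cblkr n {1..i} {1..i} p)"
      unfolding blkr_mmult_Zr[OF L L I p w(2)] wb mmult_mone_right[OF m(1)] mmult_mone_right[OF m(2)] ..
  qed
  also have "\<dots> = of_nat (card (Rv n i :: 'a mat set)) * (\<Sum>a\<in>GL i. \<Sum>b\<in>GL (n - i). T (a, b))"
    by (rule P.sum_K)
  finally show ?thesis .
qed

subsection \<open>Induction\<close>

lemma Ind_eq:
  fixes f :: "'a::{finite,field} mat \<Rightarrow> complex"
  assumes "finite G" "\<And>g. g \<notin> H \<Longrightarrow> f g = 0"
  shows "Ind n H G f g = (if g \<in> G then (\<Sum>x\<in>G. f (conjg n x g)) / of_nat (card H) else 0)"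
proof -
  have "(\<Sum>x\<in>{x\<in>G. conjg n x g \<in> H}. f (conjg n x g)) = (\<Sum>x\<in>G. f (conjg n x g))"
    using assms by (intro sum.mono_neutral_left) auto
  then show ?thesis by (simp add: Ind_def)
qed

lemma Ind2_eq:
  fixes F :: "'a::{finite,field} mat \<times> 'a mat \<Rightarrow> complex"
  assumes fin: "finite G1" "finite G2" and zero: "\<And>a b. (a, b) \<notin> H1 \<times> H2 \<Longrightarrow> F (a, b) = 0"
  shows "Ind2 m k H1 G1 H2 G2 F (x, y) = (if x \<in> G1 \<and> y \<in> G2 then
    (\<Sum>a\<in>G1. \<Sum>b\<in>G2. F (conjg m a x, conjg k b y)) / (of_nat (card H1) * of_nat (card H2)) else 0)"
proof -
  have "(\<Sum>b\<in>{b\<in>G2. conjg k b y \<in> H2}. F (conjg m a x, conjg k b y)) = (\<Sum>b\<in>G2. F (conjg m a x, conjg k b y))" for a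
    using fin zero by (intro sum.mono_neutral_left) auto
  moreover have "(\<Sum>a\<in>{a\<in>G1. conjg m a x \<in> H1}. \<Sum>b\<in>G2. F (conjg m a x, conjg k b y))
      = (\<Sum>a\<in>G1. \<Sum>b\<in>G2. F (conjg m a x, conjg k b y))"
    using fin zero by (intro sum.mono_neutral_left) (auto intro!: sum.neutral)
  ultimately show ?thesis by (simp add: Ind2_def)
qed

lemma cf_zero: "f \<in> cf n G \<Longrightarrow> g \<notin> G \<Longrightarrow> f g = 0"
  by (simp add: cf_def)

lemma IndGU_eq:
  fixes f :: "'a::{finite,field} mat \<Rightarrow> complex"
  assumes "\<And>g. g \<notin> UT n \<Longrightarrow> f g = 0"
  shows "IndGU n f g = (if g \<in> GL n then (\<Sum>x\<in>GL n. f (conjg n x g)) / of_nat (card (UT n :: 'a mat set)) else 0)"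
  unfolding IndGU_def using assms by (intro Ind_eq) auto

lemma IndGU_cf:
  fixes f :: "'a::{finite,field} mat \<Rightarrow> complex"
  assumes f: "f \<in> cf n (UT n)"
  shows "IndGU n f \<in> cf n (GL n)"
proof -
  note I = IndGU_eq[of n f, OF cf_zero[OF f]]
  have "IndGU n f (conjg n y g) = IndGU n f g" if "g \<in> GL n" "y \<in> GL n" for g y
  proof -
    have "(\<Sum>x\<in>GL n. f (conjg n x (conjg n y g))) = (\<Sum>x\<in>GL n. f (conjg n (mmult n y x) g))"
      using that by (intro sum.cong) (simp_all add: conjg_conjg)
    also have "\<dots> = (\<Sum>x\<in>GL n. f (conjg n x g))"
      by (rule sum.reindex_bij_betw[OF bij_GL_left[OF that(2)]])
    finally show ?thesis using that by (simp add: I)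
  qed
  then show ?thesis unfolding cf_def by (simp add: I)
qed

lemma IndGU_linear:
  fixes f h :: "'a::{finite,field} mat \<Rightarrow> complex"
  shows "IndGU n (\<lambda>g. c * f g + d * h g) = (\<lambda>g. c * IndGU n f g + d * IndGU n h g)"
  by (rule ext) (simp add: IndGU_def Ind_def sum.distrib add_divide_distrib flip: sum_distrib_left)

lemma matn_0: "matn 0 = {mone 0}"
  by (auto simp: matn_def mone_def)

lemma IndGU_0:
  fixes f :: "'a::{finite,field} mat \<Rightarrow> complex"
  shows "IndGU 0 f g = (if g = mone 0 then f (mone 0) else 0)"
proof -
  have G: "GL 0 = {mone 0 :: 'a mat}"
    using matn_0 mone_GL[of 0, where 'a = 'a] GL_matn by blast
  have U: "UT 0 = {mone 0 :: 'a mat}"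
    using matn_0 mone_UT[of 0, where 'a = 'a] UT_matn by blast
  have "{x \<in> GL 0. conjg 0 x (mone 0) \<in> UT 0} = {mone 0 :: 'a mat}"
    unfolding G U by auto
  then show ?thesis by (simp add: IndGU_def Ind_def G U)
qed

subsection \<open>Compatibility with the product\<close>

lemma muUT_eq:
  fixes F :: "'a::{finite,field} mat \<times> 'a mat \<Rightarrow> complex"
  assumes i: "i \<le> n"
  shows "muUT n i F = (\<lambda>g. if g \<in> UT n then F (blkr {1..i} {1..i} g, cblkr n {1..i} {1..i} g) else 0)"
proof -
  have L: "{1..i} \<subseteq> {1..n}" "card {1..i} = i" using i by auto
  interpret block_group n i "{1..i}" "UT i :: 'a mat set" "UT (n - i)" "UP n {1..i}" "UL n {1..i}" "UR n {1..i}"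
    by (rule UP_block_group[OF L])
  show ?thesis using Inf_st_inv[of F] unfolding UP_interval[OF i] muUT_def .
qed

text \<open>Factor \<open>g\<close> into its block diagonal part, unitriangular because its blocks
  are, and an element of the radical, unitriangular by \<open>fibre_mone_UT\<close>.\<close>

lemma Zr_UT:
  fixes g :: "'a::{finite,field} mat"
  assumes i: "i \<le> n" and g: "g \<in> Zr n {1..i} {1..i}"
    and ab: "blkr {1..i} {1..i} g \<in> UT i" "cblkr n {1..i} {1..i} g \<in> UT (n - i)"
  shows "g \<in> UT n"
proof -
  have L: "{1..i} \<subseteq> {1..n}" "card {1..i} = i" using i by auto
  define E where "E = embr n {1..i} {1..i} (blkr {1..i} {1..i} g) (cblkr n {1..i} {1..i} g)"
  define a b where "a = blkr {1..i} {1..i} g" and "b = cblkr n {1..i} {1..i} g"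
  have G: "a \<in> GL i" "b \<in> GL (n - i)" using ab by (simp_all add: a_def b_def)
  have E: "E \<in> UT n" unfolding E_def by (rule embr_UT[OF L ab])
  have "minv n E \<in> fibre n {1..i} (minv i a) (minv (n - i) b)"
    unfolding E_def a_def[symmetric] b_def[symmetric] minv_embr[OF L L G]
    using G by (intro embr_fibre[OF L]) auto
  moreover have "g \<in> fibre n {1..i} a b" using g by (simp add: fibre_def a_def b_def)
  ultimately have "mmult n (minv n E) g \<in> fibre n {1..i} (mmult i (minv i a) a) (mmult (n - i) (minv (n - i) b) b)"
    by (rule fibre_mmult[OF L])
  then have "mmult n (minv n E) g \<in> UT n" using fibre_mone_UT[OF i] G by auto
  then have "mmult n E (mmult n (minv n E) g) \<in> UT n" using E by simp
  then show ?thesis using E Zr_matn[OF g] by simp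
qed

lemma IndGU_muUT:
  fixes F :: "'a::{finite,field} mat \<times> 'a mat \<Rightarrow> complex"
  assumes i: "i \<le> n" and zero: "\<And>a b. (a, b) \<notin> UT i \<times> UT (n - i) \<Longrightarrow> F (a, b) = 0"
  shows "IndGU n (muUT n i F) = muGL n i (Ind2 i (n - i) (UT i) (GL i) (UT (n - i)) (GL (n - i)) F)"
proof
  fix g :: "'a mat"
  have L: "{1..i} \<subseteq> {1..n}" "card {1..i} = i" using i by auto
  interpret U: block_group n i "{1..i}" "UT i :: 'a mat set" "UT (n - i)" "UP n {1..i}" "UL n {1..i}" "UR n {1..i}"
    by (rule UP_block_group[OF L])
  interpret P: block_group n i "{1..i}" "GL i :: 'a mat set" "GL (n - i)" "Pv n i" "Lv n i" "Rv n i"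
    by (rule Pv_block_group[OF i])
  let ?F = "Ind2 i (n - i) (UT i) (GL i) (UT (n - i)) (GL (n - i)) F"
  let ?D = "embr n {1..i} {1..i} :: 'a mat \<Rightarrow> 'a mat \<Rightarrow> 'a mat"
  define f where "f = muUT n i F"
  define h where "h = (\<lambda>g. if g \<in> Pv n i then ?F (blkr {1..i} {1..i} g, cblkr n {1..i} {1..i} g) else 0)"
  define c :: complex where "c = of_nat (card (UT i :: 'a mat set)) * of_nat (card (UT (n - i) :: 'a mat set))"
  have f: "f g = (if g \<in> UT n then F (blkr {1..i} {1..i} g, cblkr n {1..i} {1..i} g) else 0)" for g
    using muUT_eq[OF i, of F] by (simp add: f_def)
  \<comment> \<open>The inflated function inside \<open>muGL\<close> is \<open>f\<close> summed over
    conjugates by block diagonal matrices and divided by \<open>c\<close>, the order of UT_i x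
    UT_(n-i).\<close>
  have h: "h z = (\<Sum>a\<in>GL i. \<Sum>b\<in>GL (n - i). f (conjg n (?D a b) z)) / c" if z: "z \<in> GL n" for z
  proof (cases "z \<in> Pv n i")
    case True
    then have zZ: "z \<in> Zr n {1..i} {1..i}" by (simp add: Pv_eq)
    define A B where "A = blkr {1..i} {1..i} z" and "B = cblkr n {1..i} {1..i} z"
    have zf: "z \<in> fibre n {1..i} A B" using zZ by (simp add: fibre_def A_def B_def)
    have AB: "A \<in> GL i" "B \<in> GL (n - i)" using P.K_blocks[OF True] by (simp_all add: A_def B_def)
    have "F (conjg i a A, conjg (n - i) b B) = f (conjg n (?D a b) z)"
      if ab: "a \<in> GL i" "b \<in> GL (n - i)" for a b
    proof -
      have m: "a \<in> matn i" "b \<in> matn (n - i)" using ab by simp_all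
      have "conjg n (?D a b) z \<in> fibre n {1..i} (conjg i a A) (conjg (n - i) b B)"
        using conjg_fibre[OF L L P.embr_in(3)[OF ab] embr_Zr[OF L(1) L(1)] zf]
        unfolding blkr_embr(1)[OF L L m(1)] blkr_embr(2)[OF L L m(2)] .
      then have *: "conjg n (?D a b) z \<in> Zr n {1..i} {1..i}"
        "blkr {1..i} {1..i} (conjg n (?D a b) z) = conjg i a A"
        "cblkr n {1..i} {1..i} (conjg n (?D a b) z) = conjg (n - i) b B"
        unfolding fibre_def by blast+
      \<comment> \<open>If both conjugated blocks were unitriangular, the whole matrix would be, by
        \<open>Zr_UT\<close>; so off \<open>UT n\<close> the value of \<open>F\<close> is zero, like
        that of \<open>f\<close>.\<close>
      have "F (conjg i a A, conjg (n - i) b B) = 0" if "conjg n (?D a b) z \<notin> UT n"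
        using Zr_UT[OF i *(1)] that unfolding *(2,3) by (intro zero) blast
      then show ?thesis unfolding f *(2,3) by simp
    qed
    then have "(\<Sum>a\<in>GL i. \<Sum>b\<in>GL (n - i). F (conjg i a A, conjg (n - i) b B))
        = (\<Sum>a\<in>GL i. \<Sum>b\<in>GL (n - i). f (conjg n (?D a b) z))"
      by (intro sum.cong refl)
    then show ?thesis
      using True AB zero unfolding h_def A_def[symmetric] B_def[symmetric] c_def by (subst Ind2_eq) auto
  next
    case False
    have "f (conjg n (?D a b) z) = 0" if ab: "a \<in> GL i" "b \<in> GL (n - i)" for a b
    proof -
      have D: "?D a b \<in> GL n" "?D a b \<in> Pv n i" using P.embr_in[OF ab] by blast+
      \<comment> \<open>\<open>UT n\<close> lies in \<open>Pv n i\<close>, which is stable under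
        conjugation by block diagonal matrices, so a unitriangular conjugate would force
        \<open>z\<close> into \<open>Pv n i\<close>.\<close>
      have "conjg n (?D a b) z \<notin> UT n"
      proof
        assume "conjg n (?D a b) z \<in> UT n"
        then have "conjg n (?D a b) z \<in> Pv n i"
          using UP_interval[OF i, where 'a = 'a] UP_eq[OF L(1), where 'a = 'a] by (auto simp: Pv_eq)
        then have "conjg n (minv n (?D a b)) (conjg n (?D a b) z) \<in> Pv n i"
          using D unfolding conjg_def[of n "minv n (?D a b)"] by (intro P.K_mmult P.K_minv) auto
        then show False using False conjg_minv_conjg(1)[OF D(1) GL_matn[OF z]] by simp
      qed
      then show ?thesis by (simp add: f)
    qed
    then show ?thesis using False by (simp add: h_def)
  qed
  have "muGL n i ?F g = Ind n (Pv n i) (GL n) h g"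
    unfolding muGL_def h_def using P.Inf_st_inv[of ?F] by simp
  also have "\<dots> = (if g \<in> GL n then (\<Sum>y\<in>GL n. h (conjg n y g)) / of_nat (card (Pv n i :: 'a mat set)) else 0)"
    by (rule Ind_eq) (simp_all add: h_def)
  also have "\<dots> = IndGU n f g"
  proof (cases "g \<in> GL n")
    case g: True
    \<comment> \<open>Conjugating by \<open>y\<close> and then by \<open>?D a b\<close> is
      conjugating by their product, and right translation permutes \<open>GL n\<close>.\<close>
    have sh: "(\<Sum>y\<in>GL n. f (conjg n (?D a b) (conjg n y g))) = (\<Sum>y\<in>GL n. f (conjg n y g))"
      if ab: "a \<in> GL i" "b \<in> GL (n - i)" for a b
    proof -
      have "(\<Sum>y\<in>GL n. f (conjg n (?D a b) (conjg n y g))) = (\<Sum>y\<in>GL n. f (conjg n (mmult n y (?D a b)) g))"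
        using P.embr_in(3)[OF ab] by (intro sum.cong) (simp_all add: conjg_conjg)
      then show ?thesis using sum.reindex_bij_betw[OF bij_GL_right[OF P.embr_in(3)[OF ab]]] by simp
    qed
    have "(\<Sum>y\<in>GL n. h (conjg n y g)) = (\<Sum>y\<in>GL n. \<Sum>a\<in>GL i. \<Sum>b\<in>GL (n - i). f (conjg n (?D a b) (conjg n y g))) / c"
      using g by (simp add: h sum_divide_distrib)
    also have "(\<Sum>y\<in>GL n. \<Sum>a\<in>GL i. \<Sum>b\<in>GL (n - i). f (conjg n (?D a b) (conjg n y g)))
      = (\<Sum>a\<in>GL i. \<Sum>y\<in>GL n. \<Sum>b\<in>GL (n - i). f (conjg n (?D a b) (conjg n y g)))"
      by (rule sum.swap)
    also have "\<dots> = (\<Sum>a\<in>GL i. \<Sum>b\<in>GL (n - i). \<Sum>y\<in>GL n. f (conjg n (?D a b) (conjg n y g)))"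
      by (intro sum.cong refl sum.swap)
    also have "\<dots> = (\<Sum>a\<in>(GL i :: 'a mat set). \<Sum>b\<in>(GL (n - i) :: 'a mat set). \<Sum>y\<in>GL n. f (conjg n y g))"
      by (intro sum.cong refl sh)
    finally have 1: "(\<Sum>y\<in>GL n. h (conjg n y g))
      = of_nat (card (GL i :: 'a mat set)) * of_nat (card (GL (n - i) :: 'a mat set)) * (\<Sum>y\<in>GL n. f (conjg n y g)) / c"
      by simp
    have R: "card (Rv n i :: 'a mat set) = card (UR n {1..i} :: 'a mat set)" using Rv_eq(2)[OF i, where 'a = 'a] by simp
    have pos: "card (GL k :: 'a mat set) \<noteq> 0" for k
      by (metis card_0_eq empty_iff finite_GL mone_GL)
    \<comment> \<open>Together with the factorisation of |P_i| from \<open>P.card_K\<close>, this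
      makes the normalising constants of both sides equal.\<close>
    have U: "of_nat (card (UT n :: 'a mat set)) = c * of_nat (card (Rv n i :: 'a mat set))"
      using U.card_K unfolding UP_interval[OF i] R c_def by simp
    show ?thesis
      using g pos unfolding IndGU_eq[of n f g, unfolded f, simplified] 1 P.card_K
      by (subst IndGU_eq) (simp_all add: f U)
  qed (simp add: IndGU_def Ind_def)
  finally show "IndGU n (muUT n i F) g = muGL n i ?F g" by (simp add: f_def)
qed

subsection \<open>Compatibility with the coproduct\<close>

text \<open>Conjugation by \<open>u\<close> also preserves the complement of \<open>UT n\<close>,
  where \<open>f\<close> is zero, so invariance extends to all matrices.\<close>

lemma cf_conjg_UT:
  fixes f :: "'a::{finite,field} mat \<Rightarrow> complex"
  assumes f: "f \<in> cf n (UT n)" and u: "u \<in> UT n" and g: "g \<in> matn n"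
  shows "f (conjg n u g) = f g"
proof (cases "g \<in> UT n")
  case True
  then show ?thesis using f u by (simp add: cf_def)
next
  case False
  then show ?thesis using conjg_UT_iff[OF u g] cf_zero[OF f] by simp
qed

text \<open>Since \<open>f\<close> is supported on \<open>UT n\<close>, restriction to
  \<open>UP n I\<close> and deflation together become an unrestricted sum over the fibre.\<close>

lemma DeltaUT_eq:
  fixes f :: "'a::{finite,field} mat \<Rightarrow> complex"
  assumes i: "i \<le> n" and f: "f \<in> cf n (UT n)"
  shows "DeltaUT n i f (a, b) = (\<Sum>I\<in>{I. I \<subseteq> {1..n} \<and> card I = i}.
    (\<Sum>g\<in>fibre n I a b. f g) / of_nat (card (UR n I :: 'a mat set)))"
  unfolding DeltaUT_def
proof (intro sum.cong refl)
  fix I assume "I \<in> {I. I \<subseteq> {1..n} \<and> card I = i}"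
  then have I: "I \<subseteq> {1..n}" "card I = i" by auto
  interpret block_group n i I "UT i :: 'a mat set" "UT (n - i)" "UP n I" "UL n I" "UR n I"
    by (rule UP_block_group[OF I])
  let ?c = "of_nat (card (UR n I :: 'a mat set)) :: complex"
  have zero: "f g = 0" if "g \<in> fibre n I a b" "g \<notin> UP n I" for g
    using that cf_zero[OF f] fibre_Zr UP_eq[OF I(1)] by blast
  show "st UT n I (Def n (UL n I) (UR n I) (Res (UP n I) f)) (a, b) = (\<Sum>g\<in>fibre n I a b. f g) / ?c"
  proof (cases "a \<in> UT i \<and> b \<in> UT (n - i)")
    case True
    then have ab: "a \<in> UT i" "b \<in> UT (n - i)" by auto
    have "st UT n I (Def n (UL n I) (UR n I) (Res (UP n I) f)) (a, b)
        = (\<Sum>r\<in>UR n I. Res (UP n I) f (mmult n (embr n I I a b) r)) / ?c"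
      using ab embr_in(1)[OF ab] I by (simp add: st_def Def_def emb_eq_embr)
    also have "\<dots> = (\<Sum>g\<in>fibre n I a b \<inter> UP n I. Res (UP n I) f g) / ?c"
      unfolding sum_R[OF ab] ..
    also have "(\<Sum>g\<in>fibre n I a b \<inter> UP n I. Res (UP n I) f g) = (\<Sum>g\<in>fibre n I a b. f g)"
      using zero by (intro sum.mono_neutral_cong_left) (auto simp: Res_def)
    finally show ?thesis .
  next
    case False
    \<comment> \<open>If \<open>a\<close> or \<open>b\<close> is not unitriangular, the fibre misses
      \<open>UP n I\<close>, whose elements have unitriangular blocks; both sides are then
      zero.\<close>
    have "f g = 0" if "g \<in> fibre n I a b" for g
    proof (rule zero[OF that], rule notI)
      assume "g \<in> UP n I"
      from K_blocks[OF this] that False show False unfolding fibre_def by blast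
    qed
    then show ?thesis using False I by (auto simp: st_def)
  qed
qed

lemma DeltaGL_eq:
  fixes f :: "'a::{finite,field} mat \<Rightarrow> complex"
  assumes i: "i \<le> n" and f: "f \<in> cf n (UT n)"
  shows "DeltaGL n i (IndGU n f) (a, b) = (if a \<in> GL i \<and> b \<in> GL (n - i) then
    (\<Sum>x\<in>GL n. \<Sum>g\<in>fibre n {1..i} a b. f (conjg n x g))
      / (of_nat (card (Rv n i :: 'a mat set)) * of_nat (card (UT n :: 'a mat set))) else 0)"
proof (cases "a \<in> GL i \<and> b \<in> GL (n - i)")
  case True
  then have ab: "a \<in> GL i" "b \<in> GL (n - i)" by auto
  interpret block_group n i "{1..i}" "GL i :: 'a mat set" "GL (n - i)" "Pv n i" "Lv n i" "Rv n i"
    by (rule Pv_block_group[OF i])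
  let ?c = "of_nat (card (Rv n i :: 'a mat set)) :: complex" and ?d = "of_nat (card (UT n :: 'a mat set)) :: complex"
  \<comment> \<open>A conjugate in \<open>UT n\<close> would make \<open>g\<close> invertible and so
    an element of \<open>Pv n i\<close>; hence the sum may run over the whole fibre.\<close>
  have zero: "f (conjg n x g) = 0" if x: "x \<in> GL n" and g: "g \<in> fibre n {1..i} a b" "g \<notin> Pv n i" for x g
  proof (rule cf_zero[OF f], rule notI)
    assume "conjg n x g \<in> UT n"
    then have "conjg n (minv n x) (conjg n x g) \<in> GL n" using x by simp
    then have "g \<in> GL n" using conjg_minv_conjg(1)[OF x fibre_matn[OF g(1)]] by simp
    then show False using g(2) fibre_Zr[OF g(1)] by (simp add: Pv_eq)
  qed
  have "DeltaGL n i (IndGU n f) (a, b)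
      = (\<Sum>r\<in>Rv n i. Res (Pv n i) (IndGU n f) (mmult n (embr n {1..i} {1..i} a b) r)) / ?c"
    using ab embr_in(1)[OF ab] by (simp add: DeltaGL_def st_def Def_def emb_eq_embr)
  also have "\<dots> = (\<Sum>g\<in>fibre n {1..i} a b \<inter> Pv n i. Res (Pv n i) (IndGU n f) g) / ?c"
    unfolding sum_R[OF ab] ..
  also have "(\<Sum>g\<in>fibre n {1..i} a b \<inter> Pv n i. Res (Pv n i) (IndGU n f) g)
      = (\<Sum>g\<in>fibre n {1..i} a b. (\<Sum>x\<in>GL n. f (conjg n x g)) / ?d)"
    using zero by (intro sum.mono_neutral_cong_left)
      (auto simp: Res_def IndGU_eq[of n f, OF cf_zero[OF f]] Pv_eq intro!: sum.neutral)
  also have "\<dots> = (\<Sum>x\<in>GL n. \<Sum>g\<in>fibre n {1..i} a b. f (conjg n x g)) / ?d"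
    unfolding sum_divide_distrib[symmetric] by (subst sum.swap) (rule refl)
  finally show ?thesis using True by simp
next
  case False
  then show ?thesis using i by (auto simp: DeltaGL_def st_def)
qed

lemma DeltaGL_IndGU:
  fixes f :: "'a::{finite,field} mat \<Rightarrow> complex"
  assumes i: "i \<le> n" and f: "f \<in> cf n (UT n)"
  shows "DeltaGL n i (IndGU n f)
    = Ind2 i (n - i) (UT i) (GL i) (UT (n - i)) (GL (n - i)) (DeltaUT n i f)"
proof
  fix ab :: "'a mat \<times> 'a mat"
  obtain a b where ab: "ab = (a, b)" by (cases ab)
  let ?\<I> = "{I. I \<subseteq> {1..n} \<and> card I = i}"
  let ?u = "\<lambda>k. of_nat (card (UT k :: 'a mat set)) :: complex"
  let ?r = "of_nat (card (Rv n i :: 'a mat set)) :: complex"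
  define S where "S = (\<lambda>I A B. \<Sum>h\<in>fibre n I A B. f h)"
  have L: "{1..i} \<subseteq> {1..n}" "card {1..i} = i" using i by auto
  have upos: "?u k \<noteq> 0" for k
    by (metis card_0_eq empty_iff finite_UT mone_UT of_nat_eq_0_iff)
  have rpos: "?r \<noteq> 0"
  proof -
    have "mone n \<in> (Rv n i :: 'a mat set)" by (auto simp: Rv_def)
    moreover have "finite (Rv n i :: 'a mat set)" unfolding Rv_def by simp
    ultimately show ?thesis by (metis card_0_eq empty_iff of_nat_eq_0_iff)
  qed
  have D0: "DeltaUT n i f (A, B) = 0" if "(A, B) \<notin> UT i \<times> UT (n - i)" for A B
    using that unfolding DeltaUT_def by (auto simp: st_def intro!: sum.neutral)
  have "DeltaGL n i (IndGU n f) (a, b)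
      = Ind2 i (n - i) (UT i) (GL i) (UT (n - i)) (GL (n - i)) (DeltaUT n i f) (a, b)"
  proof (cases "a \<in> GL i \<and> b \<in> GL (n - i)")
    case True
    then have m: "a \<in> matn i" "b \<in> matn (n - i)" by simp_all
    \<comment> \<open>Up to its normalising constants, \<open>W I\<close> is the induction from UT_i
      x UT_(n-i) of the summand of \<open>DeltaUT\<close> belonging to \<open>I\<close>.\<close>
    define W where "W = (\<lambda>I. \<Sum>A\<in>GL i. \<Sum>B\<in>GL (n - i). S I (conjg i A a) (conjg (n - i) B b))"
    have "(\<Sum>x\<in>GL n. \<Sum>g\<in>fibre n {1..i} a b. f (conjg n x g))
      = (\<Sum>I\<in>?\<I>. ?u n / of_nat (card (UP n I :: 'a mat set))
          * (\<Sum>z\<in>GL n \<inter> Zr n {1..i} I. \<Sum>g\<in>fibre n {1..i} a b. f (conjg n z g)))"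
    proof (rule sum_GL_Bruhat[OF i])
      fix x u :: "'a mat" assume x: "x \<in> GL n" and u: "u \<in> UT n"
      \<comment> \<open>Conjugating by x u means conjugating by \<open>x\<close> and then by
        \<open>u\<close>, and \<open>f\<close> absorbs the latter; this is the invariance that
        \<open>sum_GL_Bruhat\<close> requires.\<close>
      have "f (conjg n (mmult n x u) g) = f (conjg n x g)" for g
        using cf_conjg_UT[OF f u conjg_matn[of n x g]] conjg_conjg[OF UT_GL[OF u] x] by simp
      then show "(\<Sum>g\<in>fibre n {1..i} a b. f (conjg n (mmult n x u) g)) = (\<Sum>g\<in>fibre n {1..i} a b. f (conjg n x g))"
        by simp
    qed
    also have "\<dots> = (\<Sum>I\<in>?\<I>. ?u n * ?r / (?u i * ?u (n - i)) * (W I / of_nat (card (UR n I :: 'a mat set))))"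
    proof (intro sum.cong refl)
      fix I assume "I \<in> ?\<I>"
      then have I: "I \<subseteq> {1..n}" "card I = i" by auto
      interpret block_group n i I "UT i :: 'a mat set" "UT (n - i)" "UP n I" "UL n I" "UR n I"
        by (rule UP_block_group[OF I])
      have "(\<Sum>z\<in>GL n \<inter> Zr n {1..i} I. \<Sum>g\<in>fibre n {1..i} a b. f (conjg n z g))
        = (\<Sum>z\<in>GL n \<inter> Zr n {1..i} I. (\<lambda>(A, B). S I (conjg i A a) (conjg (n - i) B b)) (blkr {1..i} I z, cblkr n {1..i} I z))"
        unfolding S_def prod.case by (intro sum.cong refl sum_fibre_conjg[OF L I _ _ m]) auto
      also have "\<dots> = ?r * W I"
        unfolding sum_GL_Zr[OF i I] W_def by simp
      finally have "(\<Sum>z\<in>GL n \<inter> Zr n {1..i} I. \<Sum>g\<in>fibre n {1..i} a b. f (conjg n z g)) = ?r * W I" .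
      \<comment> \<open>By \<open>card_K\<close>, |UP_I| = |UT_i| |UT_(n-i)| |UR_I|, which leaves
        the deflation factor 1/|UR_I| and a constant independent of \<open>I\<close>.\<close>
      then show "?u n / of_nat (card (UP n I :: 'a mat set))
          * (\<Sum>z\<in>GL n \<inter> Zr n {1..i} I. \<Sum>g\<in>fibre n {1..i} a b. f (conjg n z g))
        = ?u n * ?r / (?u i * ?u (n - i)) * (W I / of_nat (card (UR n I :: 'a mat set)))"
        unfolding card_K by simp
    qed
    also have "\<dots> = ?u n * ?r / (?u i * ?u (n - i)) * (\<Sum>I\<in>?\<I>. W I / of_nat (card (UR n I :: 'a mat set)))"
      by (rule sum_distrib_left[symmetric])
    also have "(\<Sum>I\<in>?\<I>. W I / of_nat (card (UR n I :: 'a mat set)))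
        = (\<Sum>A\<in>GL i. \<Sum>B\<in>GL (n - i). DeltaUT n i f (conjg i A a, conjg (n - i) B b))"
    proof -
      have "(\<Sum>I\<in>?\<I>. W I / of_nat (card (UR n I :: 'a mat set)))
        = (\<Sum>I\<in>?\<I>. \<Sum>A\<in>GL i. \<Sum>B\<in>GL (n - i). S I (conjg i A a) (conjg (n - i) B b) / of_nat (card (UR n I :: 'a mat set)))"
        unfolding W_def sum_divide_distrib ..
      also have "\<dots> = (\<Sum>A\<in>GL i. \<Sum>I\<in>?\<I>. \<Sum>B\<in>GL (n - i). S I (conjg i A a) (conjg (n - i) B b) / of_nat (card (UR n I :: 'a mat set)))"
        by (rule sum.swap)
      also have "\<dots> = (\<Sum>A\<in>GL i. \<Sum>B\<in>GL (n - i). \<Sum>I\<in>?\<I>. S I (conjg i A a) (conjg (n - i) B b) / of_nat (card (UR n I :: 'a mat set)))"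
        by (intro sum.cong refl sum.swap)
      finally show ?thesis unfolding DeltaUT_eq[OF i f] S_def .
    qed
    \<comment> \<open>The factors |UT_n| and |R_i| cancel against the denominators of
      \<open>DeltaGL_eq\<close>, leaving those of \<open>Ind2_eq\<close>.\<close>
    finally show ?thesis
      unfolding DeltaGL_eq[OF i f] using True upos rpos by (subst Ind2_eq) (auto intro: D0)
  next
    case False
    then show ?thesis unfolding DeltaGL_eq[OF i f] by (auto simp: Ind2_def)
  qed
  then show "DeltaGL n i (IndGU n f) ab
      = Ind2 i (n - i) (UT i) (GL i) (UT (n - i)) (GL (n - i)) (DeltaUT n i f) ab"
    by (simp add: ab)
qed

text \<open>Products and coproducts are compared in each bidegree \<open>(i, n - i)\<close>, with
  class functions of a product group standing for tensors. A bialgebra homomorphism between Hopf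
  algebras commutes with the antipodes, so these clauses amount to a Hopf algebra
  homomorphism.\<close>

theorem theorem6p1:
  shows
  \<comment> \<open>graded: maps cf(UT_n) into cf(GL_n)\<close>
  "(\<forall>n. \<forall>f\<in>cf n (UT n :: ('a::{finite,field}) mat set). IndGU n f \<in> cf n (GL n))
   \<comment> \<open>linear\<close>
   \<and> (\<forall>n (c::complex) d. \<forall>f\<in>cf n (UT n :: 'a mat set). \<forall>h\<in>cf n (UT n :: 'a mat set).
        IndGU n (\<lambda>g. c * f g + d * h g) = (\<lambda>g. c * IndGU n f g + d * IndGU n h g))
   \<comment> \<open>unit\<close>
   \<and> IndGU 0 (unit0 :: 'a mat \<Rightarrow> complex) = unit0
   \<comment> \<open>counit\<close>
   \<and> (\<forall>f\<in>cf 0 (UT 0 :: 'a mat set). counit0 (IndGU 0 f) = counit0 f)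
   \<comment> \<open>multiplicative: Ind o mu = mu o (Ind tensor Ind)\<close>
   \<and> (\<forall>n i. i \<le> n \<longrightarrow> (\<forall>F\<in>cf2 i (n - i) (UT i :: 'a mat set) (UT (n - i)).
        IndGU n (muUT n i F) = muGL n i (Ind2 i (n - i) (UT i) (GL i) (UT (n - i)) (GL (n - i)) F)))
   \<comment> \<open>comultiplicative: Delta o Ind = (Ind tensor Ind) o Delta\<close>
   \<and> (\<forall>n i. i \<le> n \<longrightarrow> (\<forall>f\<in>cf n (UT n :: 'a mat set).
        DeltaGL n i (IndGU n f) = Ind2 i (n - i) (UT i) (GL i) (UT (n - i)) (GL (n - i)) (DeltaUT n i f)))"
proof (intro conjI allI ballI impI)
  show "IndGU n f \<in> cf n (GL n)" if "f \<in> cf n (UT n)" for n and f :: "'a mat \<Rightarrow> complex"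
    by (rule IndGU_cf[OF that])
  show "IndGU n (\<lambda>g. c * f g + d * h g) = (\<lambda>g. c * IndGU n f g + d * IndGU n h g)"
    for n c d and f h :: "'a mat \<Rightarrow> complex"
    by (rule IndGU_linear)
  show "IndGU 0 (unit0 :: 'a mat \<Rightarrow> complex) = unit0"
    by (simp add: fun_eq_iff IndGU_0 unit0_def)
  show "counit0 (IndGU 0 f) = counit0 f" for f :: "'a mat \<Rightarrow> complex"
    by (simp add: counit0_def IndGU_0)
  show "IndGU n (muUT n i F) = muGL n i (Ind2 i (n - i) (UT i) (GL i) (UT (n - i)) (GL (n - i)) F)"
    if "i \<le> n" "F \<in> cf2 i (n - i) (UT i) (UT (n - i))" for n i and F :: "'a mat \<times> 'a mat \<Rightarrow> complex"
    using that by (intro IndGU_muUT) (auto simp: cf2_def)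
  show "DeltaGL n i (IndGU n f) = Ind2 i (n - i) (UT i) (GL i) (UT (n - i)) (GL (n - i)) (DeltaUT n i f)"
    if "i \<le> n" "f \<in> cf n (UT n)" for n i and f :: "'a mat \<Rightarrow> complex"
    by (rule DeltaGL_IndGU[OF that])
qed

end
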